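(* Let $(M,\mathbf{F})$ be a Finsler manifold of dimension $n>2$. If $(M,\mathbf{F})$ is a Landsberg manifold with vanishing mean Berwald curvature, then $(M,\mathbf{F})$ is a Berwald manifold.
   Context: Finsler manifold: $M$ is a smooth manifold of dimension $n$, $TM_0$ is $TM$ minus the zero section, with local coordinates $(x^i,y^i)$ induced by coordinates $x^i$ of $M$. A Finsler structure is a continuous function $\mathbf{F}:TM\to\mathbb{R}$, smooth on $TM_0$, whose restriction to each $T_pM$ is a Minkowski norm: nonnegative, $\mathbf{F}(\lambda y)=\lambda\mathbf{F}(y)$ for $\lambda>0$, and $g_{ij}:=\frac12[F^2]_{y^iy^j}$ positive definite for $y\ne0$ ($F$ is $\mathbf{F}$ in coordinates). Set $(g^{ij})=(g_{ij})^{-1}$, $G^i=\frac14g^{ij}([F^2]_{y^jx^k}y^k-[F^2]_{x^j})$, $N^i_j=\partial G^i/\partial y^j$, $\frac{\delta}{\delta x^i}=\frac{\partial}{\partial x^i}-N^j_i\frac{\partial}{\partial y^j}$, $\delta y^i=\frac1F(dy^i+N^i_jdx^j)$, $A_{ijk}=\frac14F[F^2]_{y^iy^jy^k}$. The horizontal bundle $H(TM_0)$ is spanned by the $\frac{\delta}{\delta x^i}$. Chern connection: the connection $\nabla^{\rm Ch}$ on $H(TM_0)$, $\nabla^{\rm Ch}\frac{\delta}{\delta x^j}=\omega_j^i\frac{\delta}{\delta x^i}$, determined by $dx^j\wedge\omega_j^i=0$ and $dg_{ij}-g_{kj}\omega_i^k-g_{ik}\omega_j^k=2A_{ijk}\delta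 y^k$. Its curvature forms are $\Omega_j^i=d\omega_j^i-\omega_j^k\wedge\omega_k^i=\frac12R_{j\ kl}^{\ i}dx^k\wedge dx^l+P_{j\ kl}^{\ i}dx^k\wedge\delta y^l$. $(M,\mathbf{F})$ is a Berwald manifold if $P=0$ (all $P_{j\ kl}^{\ i}=0$), and a Landsberg manifold if the Landsberg curvature $L=\frac{y^j}{F}P_{j\ kl}^{\ i}(dx^k\wedge\delta y^l)\otimes\frac{\delta}{\delta x^i}$ vanishes. Mean Berwald curvature: the tensor with components $E_{jk}=\frac12\frac{\partial^2}{\partial y^j\partial y^k}\left(\frac{\partial G^m}{\partial y^m}\right)$, i.e. half the trace of the Berwald curvature $\frac{\partial^3G^i}{\partial y^j\partial y^k\partial y^l}$. *)

theory Defs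
  imports "HOL-Analysis.Analysis"
begin

section \<open>Smooth maps between normed spaces\<close>

text \<open>\<open>Ck_on k S f\<close>: the map is \<open>k\<close> times continuously differentiable on the open set \<open>S\<close>.
  For a finite-dimensional domain (the only case used below), continuity of all iterated
  directional derivatives is the usual notion.\<close>

primrec Ck_on :: "nat \<Rightarrow> 'a::real_normed_vector set \<Rightarrow> ('a \<Rightarrow> 'b::real_normed_vector) \<Rightarrow> bool" where
  "Ck_on 0 S f \<longleftrightarrow> continuous_on S f"
| "Ck_on (Suc k) S f \<longleftrightarrow> (\<forall>x\<in>S. f differentiable (at x)) \<and>
     (\<forall>v. Ck_on k S (\<lambda>x. frechet_derivative f (at x) v))"

definition smooth_on :: "'a::real_normed_vector set \<Rightarrow> ('a \<Rightarrow> 'b::real_normed_vector) \<Rightarrow> bool" where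
  "smooth_on S f \<longleftrightarrow> (\<forall>k. Ck_on k S f)"

section \<open>Smooth manifolds and their tangent bundles\<close>

type_synonym ('a, 'n) chart = "'a set \<times> ('a \<Rightarrow> real ^ 'n)"

definition chart_image :: "('a, 'n::finite) chart \<Rightarrow> (real ^ 'n) set" where
  "chart_image c = snd c ` fst c"

definition chart_inv :: "('a, 'n::finite) chart \<Rightarrow> real ^ 'n \<Rightarrow> 'a" where
  "chart_inv c = inv_into (fst c) (snd c)"

definition transition :: "('a, 'n::finite) chart \<Rightarrow> ('a, 'n) chart \<Rightarrow> real ^ 'n \<Rightarrow> real ^ 'n" where
  "transition c d = snd d \<circ> chart_inv c"

text \<open>The dimension of the manifold is \<open>CARD('n)\<close>. The atlas is not required to be maximal.\<close>

definition smooth_manifold :: "'a topology \<Rightarrow> ('a, 'n::finite) chart set \<Rightarrow> bool" where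
  "smooth_manifold X \<A> \<longleftrightarrow>
     Hausdorff_space X \<and> second_countable X \<and> topspace X = (\<Union>c\<in>\<A>. fst c) \<and>
     (\<forall>c\<in>\<A>. openin X (fst c) \<and> open (chart_image c) \<and>
        homeomorphic_map (subtopology X (fst c)) (top_of_set (chart_image c)) (snd c)) \<and>
     (\<forall>c\<in>\<A>. \<forall>d\<in>\<A>. smooth_on (snd c ` (fst c \<inter> fst d)) (transition c d))"

text \<open>A tangent vector at \<open>p\<close> is the family of its component vectors in all the charts
  around \<open>p\<close>, subject to the contravariant transformation law; at other charts the family
  is normalised to be \<open>0\<close>. Linear operations are thus taken chart by chart.\<close>

definition tangent_space ::
    "('a, 'n::finite) chart set \<Rightarrow> 'a \<Rightarrow> (('a, 'n) chart \<Rightarrow> real ^ 'n) set" where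
  "tangent_space \<A> p = {\<xi>.
     (\<forall>c\<in>\<A>. \<forall>d\<in>\<A>. p \<in> fst c \<longrightarrow> p \<in> fst d \<longrightarrow>
        \<xi> d = frechet_derivative (transition c d) (at (snd c p)) (\<xi> c)) \<and>
     (\<forall>c. \<not> (c \<in> \<A> \<and> p \<in> fst c) \<longrightarrow> \<xi> c = 0)}"

definition tangent_bundle ::
    "'a topology \<Rightarrow> ('a, 'n::finite) chart set \<Rightarrow> ('a \<times> (('a, 'n) chart \<Rightarrow> real ^ 'n)) set" where
  "tangent_bundle X \<A> = (SIGMA p:topspace X. tangent_space \<A> p)"

text \<open>The tangent vector \<open>y\<^sup>i \<partial>/\<partial>x\<^sup>i\<close> at \<open>p\<close> in the chart \<open>c\<close>.\<close>

definition coord_vector ::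
    "('a, 'n::finite) chart set \<Rightarrow> ('a, 'n) chart \<Rightarrow> 'a \<Rightarrow> real ^ 'n \<Rightarrow> (('a, 'n) chart \<Rightarrow> real ^ 'n)" where
  "coord_vector \<A> c p y = (\<lambda>d. if d \<in> \<A> \<and> p \<in> fst d
      then frechet_derivative (transition c d) (at (snd c p)) y else 0)"

lemma coord_vector_tangent_space:
  assumes M: "smooth_manifold X \<A>" and c: "c \<in> \<A>" and p: "p \<in> fst c"
  shows "coord_vector \<A> c p y \<in> tangent_space \<A> p" "coord_vector \<A> c p y c = y"
proof -
  have hom: "homeomorphic_map (subtopology X (fst d)) (top_of_set (chart_image d)) (snd d)"
    and op: "openin X (fst d)" "open (chart_image d)" if "d \<in> \<A>" for d
    using M that by (auto simp: smooth_manifold_def)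
  have sub: "fst d \<subseteq> topspace X" if "d \<in> \<A>" for d
    using op[OF that] openin_subset by blast
  have inj: "inj_on (snd d) (fst d)" if "d \<in> \<A>" for d
    using hom[OF that] sub[OF that]
    by (auto simp: homeomorphic_eq_everything_map inf.absorb2)
  have inv: "chart_inv d (snd d q) = q" if "d \<in> \<A>" "q \<in> fst d" for d q
    using inj[OF that(1)] that(2) by (simp add: chart_inv_def)
  have diff: "transition d e differentiable (at (snd d p))"
    if "d \<in> \<A>" "e \<in> \<A>" "p \<in> fst d" "p \<in> fst e" for d e
  proof -
    have "Ck_on 1 (snd d ` (fst d \<inter> fst e)) (transition d e)"
      using M that unfolding smooth_manifold_def smooth_on_def by blast
    then show ?thesis using that by auto
  qed
  have image_open: "open (snd c ` (fst c \<inter> W))" if "openin X W" for W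
  proof -
    have "open_map (subtopology X (fst c)) (top_of_set (chart_image c)) (snd c)"
      using hom[OF c] homeomorphic_imp_open_map by blast
    moreover have "openin (subtopology X (fst c)) (fst c \<inter> W)"
      using that by (simp add: openin_subtopology_Int2)
    ultimately have "openin (top_of_set (chart_image c)) (snd c ` (fst c \<inter> W))"
      by (simp add: open_map_def)
    then show ?thesis using op(2)[OF c] openin_open_eq by blast
  qed
  have cocycle: "frechet_derivative (transition c e) (at (snd c p)) y =
      frechet_derivative (transition d e) (at (snd d p))
        (frechet_derivative (transition c d) (at (snd c p)) y)"
    if d: "d \<in> \<A>" "p \<in> fst d" and e: "e \<in> \<A>" "p \<in> fst e" for d e
  proof -
    let ?S = "snd c ` (fst c \<inter> (fst d \<inter> fst e))"
    have tp: "transition c d (snd c p) = snd d p"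
      by (simp add: transition_def inv c p)
    have eq: "(transition d e \<circ> transition c d) x = transition c e x" if "x \<in> ?S" for x
      using that by (auto simp: transition_def inv c d e)
    have D1: "(transition c d has_derivative frechet_derivative (transition c d) (at (snd c p)))
        (at (snd c p))"
      using diff[OF c d(1) p d(2)] by (simp add: frechet_derivative_works)
    have D2: "(transition d e has_derivative frechet_derivative (transition d e) (at (snd d p)))
        (at (transition c d (snd c p)))"
      using diff[OF d(1) e(1) d(2) e(2)] by (simp add: frechet_derivative_works tp)
    have "((transition d e \<circ> transition c d) has_derivative
        (frechet_derivative (transition d e) (at (snd d p)) \<circ>
         frechet_derivative (transition c d) (at (snd c p)))) (at (snd c p))"
      using diff_chain_at[OF D1 D2] .
    moreover have "open ?S" "snd c p \<in> ?S"
      using image_open[OF openin_Int[OF op(1)[OF d(1)] op(1)[OF e(1)]]] d e p by auto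
    ultimately have "(transition c e has_derivative
        (frechet_derivative (transition d e) (at (snd d p)) \<circ>
         frechet_derivative (transition c d) (at (snd c p)))) (at (snd c p))"
      by (rule has_derivative_transform_within_open) (rule eq)
    from frechet_derivative_at[OF this, symmetric] show ?thesis
      by simp
  qed
  show "coord_vector \<A> c p y \<in> tangent_space \<A> p"
    unfolding tangent_space_def coord_vector_def
    by (auto intro: cocycle simp del: split_paired_All split_paired_Ex)
  have "(transition c c has_derivative (\<lambda>v. v)) (at (snd c p))"
  proof (rule has_derivative_transform_within_open[where f = "\<lambda>v. v" and s = "chart_image c"])
    show "x = transition c c x" if "x \<in> chart_image c" for x
      using that by (auto simp: chart_image_def transition_def inv c)
  qed (use op[OF c] p in \<open>auto simp: chart_image_def\<close>)
  from frechet_derivative_at[OF this, symmetric]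
  have "frechet_derivative (transition c c) (at (snd c p)) y = y"
    by simp
  then show "coord_vector \<A> c p y c = y"
    using c p by (simp add: coord_vector_def)
qed

text \<open>The induced chart \<open>(x, y)\<close> of the tangent bundle, inverted: coordinates to tangent vectors.\<close>

definition bundle_chart_inv ::
    "('a, 'n::finite) chart set \<Rightarrow> ('a, 'n) chart \<Rightarrow> (real ^ 'n) \<times> (real ^ 'n)
      \<Rightarrow> 'a \<times> (('a, 'n) chart \<Rightarrow> real ^ 'n)" where
  "bundle_chart_inv \<A> c z = (chart_inv c (fst z), coord_vector \<A> c (chart_inv c (fst z)) (snd z))"

text \<open>Coordinate domain of the slit tangent bundle over a chart.\<close>

definition slit_domain :: "('a, 'n::finite) chart \<Rightarrow> ((real ^ 'n) \<times> (real ^ 'n)) set" where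
  "slit_domain c = chart_image c \<times> (- {0})"

section \<open>Local Finsler geometry\<close>

text \<open>Throughout this section, \<open>F\<close> is the coordinate expression of a Finsler structure as a
  function of \<open>z = (x, y)\<close>, and tangent vectors of the slit tangent bundle are pairs
  \<open>u = (u\<^sub>x, u\<^sub>y)\<close> of coordinate vectors.\<close>

definition pdx :: "'n \<Rightarrow> ((real ^ 'n::finite) \<times> (real ^ 'n) \<Rightarrow> real) \<Rightarrow> (real ^ 'n) \<times> (real ^ 'n) \<Rightarrow> real" where
  "pdx i h z = frechet_derivative h (at z) (axis i 1, 0)"

definition pdy :: "'n \<Rightarrow> ((real ^ 'n::finite) \<times> (real ^ 'n) \<Rightarrow> real) \<Rightarrow> (real ^ 'n) \<times> (real ^ 'n) \<Rightarrow> real" where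
  "pdy i h z = frechet_derivative h (at z) (0, axis i 1)"

definition fundamental_tensor ::
    "((real ^ 'n::finite) \<times> (real ^ 'n) \<Rightarrow> real) \<Rightarrow> (real ^ 'n) \<times> (real ^ 'n) \<Rightarrow> real ^ 'n ^ 'n" where
  "fundamental_tensor F z = (\<chi> i j. (1/2) * pdy j (pdy i (\<lambda>w. (F w)\<^sup>2)) z)"

definition spray_coeff ::
    "((real ^ 'n::finite) \<times> (real ^ 'n) \<Rightarrow> real) \<Rightarrow> 'n \<Rightarrow> (real ^ 'n) \<times> (real ^ 'n) \<Rightarrow> real" where
  "spray_coeff F i z = (1/4) * (\<Sum>j\<in>UNIV. matrix_inv (fundamental_tensor F z) $ i $ j *
     ((\<Sum>k\<in>UNIV. pdx k (pdy j (\<lambda>w. (F w)\<^sup>2)) z * snd z $ k) - pdx j (\<lambda>w. (F w)\<^sup>2) z))"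

text \<open>\<open>nonlinear_conn F i j\<close> is \<open>N\<^sup>i\<^sub>j\<close> (upper index first).\<close>

definition nonlinear_conn ::
    "((real ^ 'n::finite) \<times> (real ^ 'n) \<Rightarrow> real) \<Rightarrow> 'n \<Rightarrow> 'n \<Rightarrow> (real ^ 'n) \<times> (real ^ 'n) \<Rightarrow> real" where
  "nonlinear_conn F i j z = pdy j (spray_coeff F i) z"

text \<open>The horizontal vector field \<open>\<delta>/\<delta>x\<^sup>i\<close> and the vertical one \<open>F \<partial>/\<partial>y\<^sup>i\<close>; together they form the
  frame dual to the coframe \<open>dx\<^sup>i, \<delta>y\<^sup>i\<close>.\<close>

definition hor_vec ::
    "((real ^ 'n::finite) \<times> (real ^ 'n) \<Rightarrow> real) \<Rightarrow> 'n \<Rightarrow> (real ^ 'n) \<times> (real ^ 'n)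
      \<Rightarrow> (real ^ 'n) \<times> (real ^ 'n)" where
  "hor_vec F i z = (axis i 1, - (\<chi> j. nonlinear_conn F j i z))"

definition ver_vec ::
    "((real ^ 'n::finite) \<times> (real ^ 'n) \<Rightarrow> real) \<Rightarrow> 'n \<Rightarrow> (real ^ 'n) \<times> (real ^ 'n)
      \<Rightarrow> (real ^ 'n) \<times> (real ^ 'n)" where
  "ver_vec F i z = (0, F z *\<^sub>R axis i 1)"

definition dx_form :: "'n \<Rightarrow> (real ^ 'n::finite) \<times> (real ^ 'n) \<Rightarrow> real" where
  "dx_form i u = fst u $ i"

definition delta_y_form ::
    "((real ^ 'n::finite) \<times> (real ^ 'n) \<Rightarrow> real) \<Rightarrow> 'n \<Rightarrow> (real ^ 'n) \<times> (real ^ 'n)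
      \<Rightarrow> (real ^ 'n) \<times> (real ^ 'n) \<Rightarrow> real" where
  "delta_y_form F i z u = (1 / F z) * (snd u $ i + (\<Sum>j\<in>UNIV. nonlinear_conn F i j z * fst u $ j))"

definition cartan_tensor ::
    "((real ^ 'n::finite) \<times> (real ^ 'n) \<Rightarrow> real) \<Rightarrow> 'n \<Rightarrow> 'n \<Rightarrow> 'n \<Rightarrow> (real ^ 'n) \<times> (real ^ 'n) \<Rightarrow> real" where
  "cartan_tensor F i j k z = (1/4) * F z * pdy k (pdy j (pdy i (\<lambda>w. (F w)\<^sup>2))) z"

definition wedge :: "('v \<Rightarrow> real) \<Rightarrow> ('v \<Rightarrow> real) \<Rightarrow> 'v \<Rightarrow> 'v \<Rightarrow> real" where
  "wedge \<alpha> \<beta> u v = \<alpha> u * \<beta> v - \<alpha> v * \<beta> u"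

text \<open>Exterior derivative of the 1-form \<open>z \<mapsto> \<alpha> z\<close> on an open subset of a vector space.\<close>

definition ext_deriv :: "('v::real_normed_vector \<Rightarrow> 'v \<Rightarrow> real) \<Rightarrow> 'v \<Rightarrow> 'v \<Rightarrow> 'v \<Rightarrow> real" where
  "ext_deriv \<alpha> z u v =
     frechet_derivative (\<lambda>w. \<alpha> w v) (at z) u - frechet_derivative (\<lambda>w. \<alpha> w u) (at z) v"

text \<open>\<open>chern_form F j i z\<close> is \<open>\<omega>\<^sub>j\<^sup>i\<close> at \<open>z\<close> (lower index first). The structure equations
  are pointwise linear-algebraic conditions on \<open>\<omega>\<close>; for a Finsler structure they have exactly one solution at each point
  with \<open>y \<noteq> 0\<close>.\<close>

definition chern_structure_eqs ::
    "((real ^ 'n::finite) \<times> (real ^ 'n) \<Rightarrow> real) \<Rightarrow> (real ^ 'n) \<times> (real ^ 'n)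
      \<Rightarrow> ('n \<Rightarrow> 'n \<Rightarrow> (real ^ 'n) \<times> (real ^ 'n) \<Rightarrow> real) \<Rightarrow> bool" where
  "chern_structure_eqs F z \<omega> \<longleftrightarrow>
     (\<forall>j i. linear (\<omega> j i)) \<and>
     (\<forall>i u v. (\<Sum>j\<in>UNIV. wedge (dx_form j) (\<omega> j i) u v) = 0) \<and>
     (\<forall>i j u. frechet_derivative (\<lambda>w. fundamental_tensor F w $ i $ j) (at z) u
          - (\<Sum>k\<in>UNIV. fundamental_tensor F z $ k $ j * \<omega> i k u)
          - (\<Sum>k\<in>UNIV. fundamental_tensor F z $ i $ k * \<omega> j k u)
        = (\<Sum>k\<in>UNIV. 2 * cartan_tensor F i j k z * delta_y_form F k z u))"

definition chern_form ::
    "((real ^ 'n::finite) \<times> (real ^ 'n) \<Rightarrow> real) \<Rightarrow> 'n \<Rightarrow> 'n \<Rightarrow> (real ^ 'n) \<times> (real ^ 'n)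
      \<Rightarrow> (real ^ 'n) \<times> (real ^ 'n) \<Rightarrow> real" where
  "chern_form F j i z = (THE \<omega>. chern_structure_eqs F z \<omega>) j i"

definition chern_curvature ::
    "((real ^ 'n::finite) \<times> (real ^ 'n) \<Rightarrow> real) \<Rightarrow> 'n \<Rightarrow> 'n \<Rightarrow> (real ^ 'n) \<times> (real ^ 'n)
      \<Rightarrow> (real ^ 'n) \<times> (real ^ 'n) \<Rightarrow> (real ^ 'n) \<times> (real ^ 'n) \<Rightarrow> real" where
  "chern_curvature F j i z u v = ext_deriv (chern_form F j i) z u v
     - (\<Sum>k\<in>UNIV. wedge (chern_form F j k z) (chern_form F k i z) u v)"

text \<open>\<open>chern_P F j i k l\<close> is the coefficient of \<open>dx\<^sup>k \<and> \<delta>y\<^sup>l\<close> in \<open>\<Omega>\<^sub>j\<^sup>i\<close>, read off on the dual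
  frame; see lemma \<open>chern_P_eq_coefficient\<close>.\<close>

definition chern_P ::
    "((real ^ 'n::finite) \<times> (real ^ 'n) \<Rightarrow> real) \<Rightarrow> 'n \<Rightarrow> 'n \<Rightarrow> 'n \<Rightarrow> 'n
      \<Rightarrow> (real ^ 'n) \<times> (real ^ 'n) \<Rightarrow> real" where
  "chern_P F j i k l z = chern_curvature F j i z (hor_vec F k z) (ver_vec F l z)"

lemma dx_form_hor_vec: "dx_form i (hor_vec F k z) = (if i = k then 1 else 0)"
  by (simp add: dx_form_def hor_vec_def axis_def)

lemma dx_form_ver_vec: "dx_form i (ver_vec F k z) = 0"
  by (simp add: dx_form_def ver_vec_def)

lemma delta_y_form_hor_vec: "delta_y_form F i z (hor_vec F k z) = 0"
proof -
  have "(\<Sum>j\<in>UNIV. nonlinear_conn F i j z * axis k 1 $ j) = nonlinear_conn F i k z"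
    by (simp add: axis_def if_distrib cong: if_cong)
  then show ?thesis
    by (simp add: delta_y_form_def hor_vec_def)
qed

lemma delta_y_form_ver_vec:
  assumes "F z \<noteq> 0"
  shows "delta_y_form F i z (ver_vec F k z) = (if i = k then 1 else 0)"
  using assms by (simp add: delta_y_form_def ver_vec_def axis_def)

lemma chern_P_eq_coefficient:
  fixes F :: "(real ^ 'n::finite) \<times> (real ^ 'n) \<Rightarrow> real"
  assumes "F z \<noteq> 0"
    and "\<And>u v. chern_curvature F j i z u v =
        (1/2) * (\<Sum>k\<in>UNIV. \<Sum>l\<in>UNIV. R k l * wedge (dx_form k) (dx_form l) u v)
        + (\<Sum>k\<in>UNIV. \<Sum>l\<in>UNIV. P k l * wedge (dx_form k) (delta_y_form F l z) u v)"
  shows "chern_P F j i k l z = P k l"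
proof -
  let ?h = "hor_vec F k z" and ?v = "ver_vec F l z"
  have xx: "wedge (dx_form a) (dx_form b) ?h ?v = 0" for a b
    by (simp add: wedge_def dx_form_ver_vec)
  have xy: "wedge (dx_form a) (delta_y_form F b z) ?h ?v = (if a = k then if b = l then 1 else 0 else 0)"
    for a b
    by (simp add: wedge_def dx_form_hor_vec dx_form_ver_vec delta_y_form_ver_vec[of F z, OF assms(1)])
  have "P a b * (if a = k then if b = l then 1 else 0 else 0)
      = (if b = l then if a = k then P k l else 0 else 0)" for a b
    by simp
  then show ?thesis
    unfolding chern_P_def assms(2) xx xy by simp
qed

text \<open>The Landsberg curvature, a 2-form with values in the horizontal bundle.\<close>

definition landsberg_curvature ::
    "((real ^ 'n::finite) \<times> (real ^ 'n) \<Rightarrow> real) \<Rightarrow> (real ^ 'n) \<times> (real ^ 'n)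
      \<Rightarrow> (real ^ 'n) \<times> (real ^ 'n) \<Rightarrow> (real ^ 'n) \<times> (real ^ 'n) \<Rightarrow> (real ^ 'n) \<times> (real ^ 'n)" where
  "landsberg_curvature F z u v =
     (\<Sum>i\<in>UNIV. \<Sum>j\<in>UNIV. \<Sum>k\<in>UNIV. \<Sum>l\<in>UNIV.
        ((snd z $ j / F z) * chern_P F j i k l z * wedge (dx_form k) (delta_y_form F l z) u v)
          *\<^sub>R hor_vec F i z)"

definition mean_berwald ::
    "((real ^ 'n::finite) \<times> (real ^ 'n) \<Rightarrow> real) \<Rightarrow> 'n \<Rightarrow> 'n \<Rightarrow> (real ^ 'n) \<times> (real ^ 'n) \<Rightarrow> real" where
  "mean_berwald F j k z = (1/2) * pdy j (pdy k (\<lambda>w. \<Sum>m\<in>UNIV. pdy m (spray_coeff F m) w)) z"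

section \<open>Finsler manifolds\<close>

definition local_expr ::
    "('a, 'n::finite) chart set \<Rightarrow> ('a \<times> (('a, 'n) chart \<Rightarrow> real ^ 'n) \<Rightarrow> real) \<Rightarrow> ('a, 'n) chart
      \<Rightarrow> (real ^ 'n) \<times> (real ^ 'n) \<Rightarrow> real" where
  "local_expr \<A> \<F> c z = \<F> (bundle_chart_inv \<A> c z)"

text \<open>Only the values of \<open>\<F>\<close> on the tangent bundle matter.\<close>

definition finsler_manifold ::
    "'a topology \<Rightarrow> ('a, 'n::finite) chart set \<Rightarrow> ('a \<times> (('a, 'n) chart \<Rightarrow> real ^ 'n) \<Rightarrow> real) \<Rightarrow> bool" where
  "finsler_manifold X \<A> \<F> \<longleftrightarrow>
     smooth_manifold X \<A> \<and>
     (\<forall>c\<in>\<A>. continuous_on (chart_image c \<times> UNIV) (local_expr \<A> \<F> c)) \<and>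
     (\<forall>c\<in>\<A>. smooth_on (slit_domain c) (local_expr \<A> \<F> c)) \<and>
     (\<forall>(p, \<xi>)\<in>tangent_bundle X \<A>. \<F> (p, \<xi>) \<ge> 0) \<and>
     (\<forall>(p, \<xi>)\<in>tangent_bundle X \<A>. \<forall>t>0. \<F> (p, \<lambda>c. t *\<^sub>R \<xi> c) = t * \<F> (p, \<xi>)) \<and>
     (\<forall>c\<in>\<A>. \<forall>z\<in>slit_domain c. \<forall>v. v \<noteq> 0 \<longrightarrow>
        v \<bullet> (fundamental_tensor (local_expr \<A> \<F> c) z *v v) > 0)"

definition berwald_manifold ::
    "'a topology \<Rightarrow> ('a, 'n::finite) chart set \<Rightarrow> ('a \<times> (('a, 'n) chart \<Rightarrow> real ^ 'n) \<Rightarrow> real) \<Rightarrow> bool" where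
  "berwald_manifold X \<A> \<F> \<longleftrightarrow> finsler_manifold X \<A> \<F> \<and>
     (\<forall>c\<in>\<A>. \<forall>z\<in>slit_domain c. \<forall>i j k l. chern_P (local_expr \<A> \<F> c) j i k l z = 0)"

definition landsberg_manifold ::
    "'a topology \<Rightarrow> ('a, 'n::finite) chart set \<Rightarrow> ('a \<times> (('a, 'n) chart \<Rightarrow> real ^ 'n) \<Rightarrow> real) \<Rightarrow> bool" where
  "landsberg_manifold X \<A> \<F> \<longleftrightarrow> finsler_manifold X \<A> \<F> \<and>
     (\<forall>c\<in>\<A>. \<forall>z\<in>slit_domain c. \<forall>u v. landsberg_curvature (local_expr \<A> \<F> c) z u v = 0)"

definition vanishing_mean_berwald ::
    "('a, 'n::finite) chart set \<Rightarrow> ('a \<times> (('a, 'n) chart \<Rightarrow> real ^ 'n) \<Rightarrow> real) \<Rightarrow> bool" where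
  "vanishing_mean_berwald \<A> \<F> \<longleftrightarrow>
     (\<forall>c\<in>\<A>. \<forall>z\<in>slit_domain c. \<forall>j k. mean_berwald (local_expr \<A> \<F> c) j k z = 0)"

end

(*
Write f = F^2, g = (1/2) Hess_y f and h = g^-1, and let N be the nonlinear connection. The Chern
forms are Gamma^i_jk dx^k, P is - F dGamma/dy, and contracting Gamma with y gives N. In the
Landsberg case this forces Gamma = dN/dy, so that P = 0 means that N is linear in y.
Differentiating the horizontal constancy of g along the fibre shows that the lowered Berwald
curvature is totally symmetric; hence its trace is the mean Berwald curvature and
h^ab (N^i_k)_ab = 0.

So it remains to see that u of degree 1 on R^n minus 0 with h^ab u_ab = 0 has u_ab = 0, which
is Hilbert's equality case of the Brunn-Minkowski inequality. The cofactor matrix det(g) h is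
divergence free, and so is its linearisation in the direction u, which is - det(g) V with
V^ij = h^ia h^jb u_ab. By homogeneity V is annihilated by df. Therefore
div(eta(f) det(g) V grad u) = eta(f) det(g) V^ij u_ij >= 0 for a cutoff eta, and integrating
over R^n gives the claim.
*)
theory Submission
  imports Defs
begin

section \<open>Directional derivatives and smooth functions\<close>

text \<open>The equality Gamma = dN/dy arises by differentiating y^j Gamma^i_jk = N^i_k along y^l:
  besides Gamma^i_lk this leaves y contracted with dGamma/dy, which is the Landsberg curvature up to
  sign. Put H = Hess u. If H is added to g to first order, det(g) h changes by det(g) (tr(hH) h -
  hHh); the trace condition removes the first term, and V = hHh is what remains. Its divergence is
  nevertheless computed directly, and the total symmetry of the third derivatives of f makes the
  terms cancel. The obstacle is the origin of the fibre: neither g nor u need extend smoothly to y =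
  0, and homogeneous functions do not decay at infinity, so the divergence cannot be integrated as
  it stands. A cutoff removes both ends. Usually its gradient would add an uncontrolled term, but
  the gradient of a function of f is a multiple of df, and df annihilates the flux. So the integral
  keeps only the nonnegative term tr(hHhH). Throughout this part x is fixed and all derivatives are
  fibre derivatives.\<close>

definition dir_deriv :: "'a::real_normed_vector \<Rightarrow> ('a \<Rightarrow> 'b::real_normed_vector) \<Rightarrow> 'a \<Rightarrow> 'b" where
  "dir_deriv v f z = frechet_derivative f (at z) v"

lemma dir_deriv_has_derivative:
  assumes "f differentiable (at z)"
  shows "(f has_derivative (\<lambda>v. dir_deriv v f z)) (at z)"
  using assms by (simp add: dir_deriv_def frechet_derivative_works)

lemma dir_derivI: "(f has_derivative f') (at z) \<Longrightarrow> dir_deriv v f z = f' v"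
  by (simp add: dir_deriv_def frechet_derivative_at[symmetric])

lemma has_derivative_cong_open:
  assumes "open S" "z \<in> S" "\<And>w. w \<in> S \<Longrightarrow> f w = g w"
  shows "(f has_derivative D) (at z) \<longleftrightarrow> (g has_derivative D) (at z)"
  using has_derivative_transform_within_open[of f D z UNIV S g]
    has_derivative_transform_within_open[of g D z UNIV S f] assms by metis

lemma dir_deriv_cong:
  assumes "open S" "z \<in> S" "\<And>w. w \<in> S \<Longrightarrow> f w = g w"
  shows "dir_deriv v f z = dir_deriv v g z"
  using has_derivative_cong_open[of S z f g] assms
  by (simp add: dir_deriv_def frechet_derivative_def)

lemma dir_deriv_const [simp]: "dir_deriv v (\<lambda>w. c) z = 0"
  by (simp add: dir_deriv_def)

lemma dir_deriv_add:
  assumes "f differentiable (at z)" "g differentiable (at z)"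
  shows "dir_deriv v (\<lambda>w. f w + g w) z = dir_deriv v f z + dir_deriv v g z"
  by (rule dir_derivI) (intro has_derivative_add dir_deriv_has_derivative assms)

lemma dir_deriv_diff:
  assumes "f differentiable (at z)" "g differentiable (at z)"
  shows "dir_deriv v (\<lambda>w. f w - g w) z = dir_deriv v f z - dir_deriv v g z"
  by (rule dir_derivI) (intro has_derivative_diff dir_deriv_has_derivative assms)

lemma dir_deriv_mult:
  fixes f g :: "'a::real_normed_vector \<Rightarrow> real"
  assumes "f differentiable (at z)" "g differentiable (at z)"
  shows "dir_deriv v (\<lambda>w. f w * g w) z = f z * dir_deriv v g z + dir_deriv v f z * g z"
  by (rule dir_derivI) (intro has_derivative_mult dir_deriv_has_derivative assms)

lemma dir_deriv_cmult:
  fixes f :: "'a::real_normed_vector \<Rightarrow> real"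
  assumes "f differentiable (at z)"
  shows "dir_deriv v (\<lambda>w. c * f w) z = c * dir_deriv v f z"
  by (rule dir_derivI) (intro has_derivative_mult_right dir_deriv_has_derivative assms)

lemma dir_deriv_sum:
  assumes "\<And>i. i \<in> I \<Longrightarrow> f i differentiable (at z)"
  shows "dir_deriv v (\<lambda>w. \<Sum>i\<in>I. f i w) z = (\<Sum>i\<in>I. dir_deriv v (f i) z)"
  by (rule dir_derivI) (intro has_derivative_sum dir_deriv_has_derivative assms)

lemma dir_deriv_linear:
  assumes "f differentiable (at z)"
  shows "linear (\<lambda>v. dir_deriv v f z)"
  using dir_deriv_has_derivative[OF assms] by (rule has_derivative_linear)

section \<open>Closure properties of C^k and smooth functions\<close>

lemma Ck_on_Suc_dir_deriv:
  "Ck_on (Suc k) S f \<longleftrightarrow> (\<forall>x\<in>S. f differentiable (at x)) \<and> (\<forall>v. Ck_on k S (dir_deriv v f))"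
  by (simp add: dir_deriv_def[abs_def])

lemma Ck_on_SucD:
  assumes "Ck_on (Suc k) S f"
  shows "x \<in> S \<Longrightarrow> (f has_derivative (\<lambda>v. dir_deriv v f x)) (at x)" "Ck_on k S (dir_deriv v f)"
  using assms unfolding Ck_on_Suc_dir_deriv by (auto intro: dir_deriv_has_derivative)

text \<open>Openness matters: the derivatives in \<open>Ck_on\<close> are taken at the point and not
  within S, so agreement on S transfers them only because S is a neighbourhood of each of its
  points.\<close>

lemma Ck_on_cong:
  assumes "open S" "\<And>x. x \<in> S \<Longrightarrow> f x = g x" "Ck_on k S f"
  shows "Ck_on k S g"
  using assms(2,3)
proof (induction k arbitrary: f g)
  case 0
  then show ?case by (simp cong: continuous_on_cong)
next
  case (Suc k)
  have eq: "dir_deriv v f x = dir_deriv v g x" if "x \<in> S" for v x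
    by (rule dir_deriv_cong[OF \<open>open S\<close> that Suc.prems(1)])
  have d: "(g has_derivative (\<lambda>v. dir_deriv v f x)) (at x)" if "x \<in> S" for x
    by (rule has_derivative_cong_open[THEN iffD1, OF \<open>open S\<close> that Suc.prems(1)
          Ck_on_SucD(1)[OF Suc.prems(2) that]])
  show ?case unfolding Ck_on_Suc_dir_deriv
  proof (intro conjI ballI allI)
    show "g differentiable (at x)" if "x \<in> S" for x
      using d[OF that] unfolding differentiable_def by blast
    show "Ck_on k S (dir_deriv v g)" for v
      by (rule Suc.IH[OF eq Ck_on_SucD(2)[OF Suc.prems(2)]])
  qed
qed

text \<open>Lets an induction step exhibit a derivative \<open>D x\<close> by a formula that is
  valid on S only; \<open>dir_deriv v f\<close> agrees with it there, and nothing is asked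
  elsewhere.\<close>

lemma Ck_on_SucI:
  assumes "open S" "\<And>x. x \<in> S \<Longrightarrow> (f has_derivative D x) (at x)"
    and "\<And>v. Ck_on k S (\<lambda>x. D x v)"
  shows "Ck_on (Suc k) S f"
  unfolding Ck_on_Suc_dir_deriv
proof (intro conjI ballI allI)
  show "f differentiable (at x)" if "x \<in> S" for x
    using assms(2)[OF that] unfolding differentiable_def by blast
  show "Ck_on k S (dir_deriv v f)" for v
    by (rule Ck_on_cong[OF \<open>open S\<close> _ assms(3)[of v]]) (simp add: dir_derivI[OF assms(2)])
qed

text \<open>Product and inverse rules keep the undifferentiated function as a factor, so their
  inductions have to lower its order by one.\<close>

lemma Ck_on_Suc_imp: "Ck_on (Suc k) S f \<Longrightarrow> Ck_on k S f"
proof (induction k arbitrary: f)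
  case 0
  have "isCont f x" if "x \<in> S" for x
    using Ck_on_SucD(1)[OF 0 that] by (rule has_derivative_continuous)
  then show ?case by (simp add: continuous_at_imp_continuous_on)
next
  case (Suc k)
  then show ?case unfolding Ck_on_Suc_dir_deriv[of "Suc k"] Ck_on_Suc_dir_deriv[of k] by blast
qed

lemma Ck_on_const: "Ck_on k S (\<lambda>x. c)"
proof (induction k arbitrary: c)
  case (Suc k)
  have "dir_deriv v (\<lambda>x. c) = (\<lambda>x. 0)" for v :: 'a by auto
  with Suc.IH[of 0] show ?case unfolding Ck_on_Suc_dir_deriv by simp
qed simp

lemma Ck_on_add:
  assumes "open S" "Ck_on k S f" "Ck_on k S g"
  shows "Ck_on k S (\<lambda>x. f x + g x)"
  using assms(2,3)
proof (induction k arbitrary: f g)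
  case 0
  then show ?case by (simp add: continuous_on_add)
next
  case (Suc k)
  show ?case
    by (rule Ck_on_SucI[OF \<open>open S\<close> has_derivative_add[OF Ck_on_SucD(1)[OF Suc.prems(1)]
          Ck_on_SucD(1)[OF Suc.prems(2)]] Suc.IH[OF Ck_on_SucD(2)[OF Suc.prems(1)]
          Ck_on_SucD(2)[OF Suc.prems(2)]]])
qed

lemma Ck_on_mult:
  fixes f g :: "'a::real_normed_vector \<Rightarrow> real"
  assumes "open S" "Ck_on k S f" "Ck_on k S g"
  shows "Ck_on k S (\<lambda>x. f x * g x)"
  using assms(2,3)
proof (induction k arbitrary: f g)
  case 0
  then show ?case by (simp add: continuous_on_mult)
next
  case (Suc k)
  note d = Ck_on_SucD[OF Suc.prems(1)] Ck_on_SucD[OF Suc.prems(2)]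
  have "Ck_on k S (\<lambda>x. f x * dir_deriv v g x + dir_deriv v f x * g x)" for v
    by (rule Ck_on_add[OF \<open>open S\<close> Suc.IH[OF Ck_on_Suc_imp[OF Suc.prems(1)] d(4)]
          Suc.IH[OF d(2) Ck_on_Suc_imp[OF Suc.prems(2)]]])
  from Ck_on_SucI[OF \<open>open S\<close> has_derivative_mult[OF d(1) d(3)] this] show ?case .
qed

lemma Ck_on_inverse:
  fixes f :: "'a::real_normed_vector \<Rightarrow> real"
  assumes "open S" "Ck_on k S f" "\<And>x. x \<in> S \<Longrightarrow> f x \<noteq> 0"
  shows "Ck_on k S (\<lambda>x. inverse (f x))"
  using assms(2)
proof (induction k)
  case 0
  then show ?case using assms(3) by (simp add: continuous_on_inverse)
next
  case (Suc k)
  note inv = Suc.IH[OF Ck_on_Suc_imp[OF Suc.prems]]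
  have "((\<lambda>x. inverse (f x)) has_derivative
      (\<lambda>v. (-1) * (inverse (f x) * dir_deriv v f x * inverse (f x)))) (at x)" if "x \<in> S" for x
    using Deriv.has_derivative_inverse[OF assms(3)[OF that] Ck_on_SucD(1)[OF Suc.prems that]] by simp
  moreover have "Ck_on k S (\<lambda>x. (-1) * (inverse (f x) * dir_deriv v f x * inverse (f x)))" for v
    by (rule Ck_on_mult[OF \<open>open S\<close> Ck_on_const Ck_on_mult[OF \<open>open S\<close>
          Ck_on_mult[OF \<open>open S\<close> inv Ck_on_SucD(2)[OF Suc.prems]] inv]])
  ultimately show ?case by (rule Ck_on_SucI[OF \<open>open S\<close>])
qed

lemma smooth_on_dir_deriv: "smooth_on S f \<Longrightarrow> smooth_on S (dir_deriv v f)"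
  unfolding smooth_on_def using Ck_on_Suc_dir_deriv by blast

lemma smooth_on_differentiable: "smooth_on S f \<Longrightarrow> x \<in> S \<Longrightarrow> f differentiable (at x)"
  unfolding smooth_on_def using Ck_on_Suc_dir_deriv by blast

lemma smooth_on_continuous_on: "smooth_on S f \<Longrightarrow> continuous_on S f"
  unfolding smooth_on_def using Ck_on.simps(1) by blast

lemma smooth_on_cong:
  "open S \<Longrightarrow> (\<And>x. x \<in> S \<Longrightarrow> f x = g x) \<Longrightarrow> smooth_on S f \<Longrightarrow> smooth_on S g"
  unfolding smooth_on_def using Ck_on_cong by blast

lemma smooth_on_const: "smooth_on S (\<lambda>x. c)"
  by (simp add: smooth_on_def Ck_on_const)

lemma smooth_on_add:
  "open S \<Longrightarrow> smooth_on S f \<Longrightarrow> smooth_on S g \<Longrightarrow> smooth_on S (\<lambda>x. f x + g x)"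
  by (simp add: smooth_on_def Ck_on_add)

lemma smooth_on_mult:
  fixes f g :: "'a::real_normed_vector \<Rightarrow> real"
  shows "open S \<Longrightarrow> smooth_on S f \<Longrightarrow> smooth_on S g \<Longrightarrow> smooth_on S (\<lambda>x. f x * g x)"
  by (simp add: smooth_on_def Ck_on_mult)

lemma smooth_on_diff:
  fixes f g :: "'a::real_normed_vector \<Rightarrow> real"
  assumes "open S" "smooth_on S f" "smooth_on S g"
  shows "smooth_on S (\<lambda>x. f x - g x)"
  using smooth_on_add[OF assms(1,2) smooth_on_mult[OF assms(1) smooth_on_const[of S "-1"] assms(3)]]
  by simp

lemma smooth_on_inverse:
  fixes f :: "'a::real_normed_vector \<Rightarrow> real"
  shows "open S \<Longrightarrow> smooth_on S f \<Longrightarrow> (\<And>x. x \<in> S \<Longrightarrow> f x \<noteq> 0) \<Longrightarrow> smooth_on S (\<lambda>x. inverse (f x))"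
  by (simp add: smooth_on_def Ck_on_inverse)

lemma smooth_on_sum:
  assumes "open S" "\<And>i. i \<in> I \<Longrightarrow> smooth_on S (f i)"
  shows "smooth_on S (\<lambda>x. \<Sum>i\<in>I. f i x)"
  using assms(2)
  by (induction I rule: infinite_finite_induct) (auto intro!: smooth_on_const smooth_on_add[OF assms(1)])

lemma smooth_on_prod:
  fixes f :: "'i \<Rightarrow> 'a::real_normed_vector \<Rightarrow> real"
  assumes "open S" "\<And>i. i \<in> I \<Longrightarrow> smooth_on S (f i)"
  shows "smooth_on S (\<lambda>x. \<Prod>i\<in>I. f i x)"
  using assms(2)
  by (induction I rule: infinite_finite_induct) (auto intro!: smooth_on_const smooth_on_mult[OF assms(1)])

lemma smooth_on_linear:
  fixes f :: "'a::real_normed_vector \<Rightarrow> 'b::real_normed_vector"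
  assumes "bounded_linear f"
  shows "smooth_on S f"
proof -
  have "Ck_on (Suc k) S f" for k
    unfolding Ck_on_Suc_dir_deriv
  proof (intro conjI ballI allI)
    note d = bounded_linear_imp_has_derivative[OF assms]
    show "f differentiable (at x)" for x using d unfolding differentiable_def by blast
    have "dir_deriv v f = (\<lambda>x. f v)" for v by (rule ext) (rule dir_derivI[OF d])
    then show "Ck_on k S (dir_deriv v f)" for v by (simp add: Ck_on_const)
  qed
  then show ?thesis unfolding smooth_on_def using Ck_on_Suc_imp by blast
qed

section \<open>Symmetry of second derivatives\<close>

lemma dir_deriv_line:
  assumes "f differentiable (at (x + t *\<^sub>R v))"
  shows "((\<lambda>t. f (x + t *\<^sub>R v)) has_vector_derivative dir_deriv v f (x + t *\<^sub>R v)) (at t)"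
proof -
  have "((\<lambda>t. x + t *\<^sub>R v) has_derivative (\<lambda>s. s *\<^sub>R v)) (at t)"
    by (auto intro!: derivative_eq_intros)
  from diff_chain_at[OF this dir_deriv_has_derivative[OF assms]]
  show ?thesis
    by (simp add: has_vector_derivative_def o_def linear_cmul[OF dir_deriv_linear[OF assms]])
qed

text \<open>The mean value theorem is applied along v to the difference of two parallel segments and
  then along w to \<open>dir_deriv v f\<close>. The second difference itself does not change when v
  and w are exchanged.\<close>

lemma second_difference_mvt:
  fixes f :: "'a::real_normed_vector \<Rightarrow> real"
  assumes "smooth_on S f" "0 < t"
    and sub: "\<And>a b. 0 \<le> a \<Longrightarrow> a \<le> t \<Longrightarrow> 0 \<le> b \<Longrightarrow> b \<le> t \<Longrightarrow> z + a *\<^sub>R v + b *\<^sub>R w \<in> S"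
  obtains a b where "0 \<le> a" "a \<le> t" "0 \<le> b" "b \<le> t"
    "f (z + t *\<^sub>R v + t *\<^sub>R w) - f (z + t *\<^sub>R v) - f (z + t *\<^sub>R w) + f z
      = t * t * dir_deriv w (dir_deriv v f) (z + a *\<^sub>R v + b *\<^sub>R w)"
proof -
  have d: "((\<lambda>a. f (z + b *\<^sub>R w + a *\<^sub>R v)) has_real_derivative dir_deriv v f (z + b *\<^sub>R w + a *\<^sub>R v)) (at a)"
    if "0 \<le> a" "a \<le> t" "0 \<le> b" "b \<le> t" for a b
    using dir_deriv_line[of f "z + b *\<^sub>R w" a v] sub[of a b] that
      smooth_on_differentiable[OF assms(1), of "z + a *\<^sub>R v + b *\<^sub>R w"]
    by (simp add: add.assoc add.commute[of "_ *\<^sub>R v" "_ *\<^sub>R w"] has_real_derivative_iff_has_vector_derivative)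
  have "\<exists>a>0. a < t \<and> (f (z + t *\<^sub>R w + t *\<^sub>R v) - f (z + 0 *\<^sub>R w + t *\<^sub>R v))
      - (f (z + t *\<^sub>R w + 0 *\<^sub>R v) - f (z + 0 *\<^sub>R w + 0 *\<^sub>R v))
    = (t - 0) * (dir_deriv v f (z + t *\<^sub>R w + a *\<^sub>R v) - dir_deriv v f (z + 0 *\<^sub>R w + a *\<^sub>R v))"
    using \<open>0 < t\<close> by (intro MVT2[where f = "\<lambda>a. f (z + t *\<^sub>R w + a *\<^sub>R v) - f (z + 0 *\<^sub>R w + a *\<^sub>R v)"]
        DERIV_diff d) auto
  then obtain a where a: "0 < a" "a < t" and eq1:
    "(f (z + t *\<^sub>R w + t *\<^sub>R v) - f (z + t *\<^sub>R v)) - (f (z + t *\<^sub>R w) - f z)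
      = t * (dir_deriv v f (z + t *\<^sub>R w + a *\<^sub>R v) - dir_deriv v f (z + a *\<^sub>R v))"
    by auto
  have d2: "((\<lambda>b. dir_deriv v f (z + a *\<^sub>R v + b *\<^sub>R w)) has_real_derivative
      dir_deriv w (dir_deriv v f) (z + a *\<^sub>R v + b *\<^sub>R w)) (at b)" if "0 \<le> b" "b \<le> t" for b
    using dir_deriv_line[of "dir_deriv v f" "z + a *\<^sub>R v" b w] sub[of a b] that a
      smooth_on_differentiable[OF smooth_on_dir_deriv[OF assms(1)], of "z + a *\<^sub>R v + b *\<^sub>R w" v]
    by (simp add: has_real_derivative_iff_has_vector_derivative)
  have "\<exists>b>0. b < t \<and> dir_deriv v f (z + a *\<^sub>R v + t *\<^sub>R w) - dir_deriv v f (z + a *\<^sub>R v + 0 *\<^sub>R w)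
    = (t - 0) * dir_deriv w (dir_deriv v f) (z + a *\<^sub>R v + b *\<^sub>R w)"
    using \<open>0 < t\<close> by (intro MVT2 d2) auto
  then obtain b where "0 < b" "b < t" "dir_deriv v f (z + a *\<^sub>R v + t *\<^sub>R w) - dir_deriv v f (z + a *\<^sub>R v)
    = t * dir_deriv w (dir_deriv v f) (z + a *\<^sub>R v + b *\<^sub>R w)"
    by auto
  with eq1 a show thesis
    by (intro that[of a b]) (auto simp: add.assoc add.commute[of "_ *\<^sub>R v" "_ *\<^sub>R w"])
qed

text \<open>Schwarz's theorem. Both mixed derivatives take the same value, the second difference
  over \<open>t * t\<close>, somewhere in an arbitrarily small parallelogram at z; continuity
  carries both values to z.\<close>

lemma dir_deriv_commute:
  fixes f :: "'a::real_normed_vector \<Rightarrow> real"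
  assumes "open S" "smooth_on S f" "z \<in> S"
  shows "dir_deriv v (dir_deriv w f) z = dir_deriv w (dir_deriv v f) z"
proof (rule ccontr)
  let ?p = "dir_deriv v (dir_deriv w f)" and ?q = "dir_deriv w (dir_deriv v f)"
  assume ne: "?p z \<noteq> ?q z"
  define e where "e = dist (?p z) (?q z) / 2"
  have "e > 0" using ne by (simp add: e_def)
  have "continuous_on S ?p" "continuous_on S ?q"
    by (intro smooth_on_continuous_on smooth_on_dir_deriv assms)+
  then have "isCont ?p z" "isCont ?q z"
    using assms continuous_on_eq_continuous_at by blast+
  then obtain d1 d2 where d: "d1 > 0" "\<And>x. dist x z < d1 \<Longrightarrow> dist (?p x) (?p z) < e"
    "d2 > 0" "\<And>x. dist x z < d2 \<Longrightarrow> dist (?q x) (?q z) < e"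
    using \<open>e > 0\<close> unfolding continuous_at_eps_delta by (metis dist_commute)
  obtain d3 where d3: "d3 > 0" "\<And>x. dist x z < d3 \<Longrightarrow> x \<in> S"
    using assms by (meson open_dist)
  define r where "r = min d1 (min d2 d3)"
  \<comment> \<open>The parallelogram with sides t v and t w then stays within r / 2 of z; the
    summand 1 keeps the denominator positive when v = w = 0.\<close>
  define t where "t = r / (2 * (norm v + norm w + 1))"
  have "r > 0" using d d3 by (simp add: r_def)
  have t: "t > 0" using \<open>r > 0\<close> by (simp add: t_def add_nonneg_pos)
  have near: "dist (z + a *\<^sub>R v + b *\<^sub>R w) z < r" if "0 \<le> a" "a \<le> t" "0 \<le> b" "b \<le> t" for a b
  proof -
    have "dist (z + a *\<^sub>R v + b *\<^sub>R w) z = norm (a *\<^sub>R v + b *\<^sub>R w)"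
      by (simp add: dist_norm add.assoc)
    also have "\<dots> \<le> a * norm v + b * norm w"
      using norm_triangle_ineq[of "a *\<^sub>R v" "b *\<^sub>R w"] that by simp
    also have "\<dots> \<le> t * norm v + t * norm w"
      using that by (intro add_mono mult_right_mono) auto
    also have "\<dots> \<le> t * (norm v + norm w + 1)" using t by (simp add: algebra_simps)
    also have "\<dots> = r / 2"
      using norm_ge_zero[of v] norm_ge_zero[of w] by (simp add: t_def field_simps add_nonneg_eq_0_iff)
    finally show ?thesis using \<open>r > 0\<close> by simp
  qed
  have inS: "z + a *\<^sub>R v + b *\<^sub>R w \<in> S" if "0 \<le> a" "a \<le> t" "0 \<le> b" "b \<le> t" for a b
    using near[OF that] d3(2) by (simp add: r_def)
  have inS': "z + a *\<^sub>R w + b *\<^sub>R v \<in> S" if "0 \<le> a" "a \<le> t" "0 \<le> b" "b \<le> t" for a b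
    using inS[of b a] that by (simp add: add.assoc add.commute[of "_ *\<^sub>R v" "_ *\<^sub>R w"])
  obtain a b where ab: "0 \<le> a" "a \<le> t" "0 \<le> b" "b \<le> t"
    "f (z + t *\<^sub>R v + t *\<^sub>R w) - f (z + t *\<^sub>R v) - f (z + t *\<^sub>R w) + f z = t * t * ?q (z + a *\<^sub>R v + b *\<^sub>R w)"
    using second_difference_mvt[OF assms(2) t inS] by blast
  obtain c d' where cd: "0 \<le> c" "c \<le> t" "0 \<le> d'" "d' \<le> t"
    "f (z + t *\<^sub>R w + t *\<^sub>R v) - f (z + t *\<^sub>R w) - f (z + t *\<^sub>R v) + f z = t * t * ?p (z + c *\<^sub>R w + d' *\<^sub>R v)"
    using second_difference_mvt[OF assms(2) t inS'] by blast
  have swap: "z + r *\<^sub>R w + s *\<^sub>R v = z + s *\<^sub>R v + r *\<^sub>R w" for r s by simp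
  have "t * t * ?p (z + d' *\<^sub>R v + c *\<^sub>R w) = t * t * ?q (z + a *\<^sub>R v + b *\<^sub>R w)"
    using ab(5) cd(5) unfolding swap[of t t] swap[of c d'] by linarith
  then have "?p (z + d' *\<^sub>R v + c *\<^sub>R w) = ?q (z + a *\<^sub>R v + b *\<^sub>R w)"
    using t by simp
  moreover have "dist (?p (z + d' *\<^sub>R v + c *\<^sub>R w)) (?p z) < e"
    using near[of d' c] cd d(2) by (simp add: r_def)
  moreover have "dist (?q (z + a *\<^sub>R v + b *\<^sub>R w)) (?q z) < e"
    using near[of a b] ab d(4) by (simp add: r_def)
  ultimately have "dist (?p z) (?q z) < e + e"
    by (metis dist_commute dist_triangle_lt add_strict_mono dist_triangle_less_add)
  then show False by (simp add: e_def)
qed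

section \<open>Determinants and inverses of matrix functions\<close>

lemma det_update_row:
  fixes A :: "real ^ 'n::finite ^ 'n"
  shows "det (\<chi> r. if r = i then b else A $ r)
    = (\<Sum>p | p permutes UNIV. of_int (sign p) * (b $ p i * (\<Prod>j\<in>UNIV - {i}. A $ j $ p j)))"
proof -
  have "(\<Prod>r\<in>UNIV. (\<chi> r. if r = i then b else A $ r) $ r $ p r)
      = b $ p i * (\<Prod>j\<in>UNIV - {i}. A $ j $ p j)" for p
    by (subst prod.remove[of UNIV i]) (auto intro: prod.cong)
  then show ?thesis by (simp add: det_def)
qed

text \<open>Jacobi's formula. The Leibniz expansion differentiates to a sum of determinants with one
  row replaced by its derivative, and Cramer's lemma evaluates each of them.\<close>

lemma has_derivative_det:
  fixes A :: "'a::real_normed_vector \<Rightarrow> real ^ 'n::finite ^ 'n"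
  assumes d: "\<And>i j. ((\<lambda>z. A z $ i $ j) has_derivative A' i j) (at z)"
    and inv: "H ** A z = mat 1"
  shows "((\<lambda>z. det (A z)) has_derivative
    (\<lambda>v. det (A z) * (\<Sum>i\<in>UNIV. \<Sum>j\<in>UNIV. A' i j v * H $ j $ i))) (at z)"
proof -
  let ?r = "\<lambda>v i. (\<chi> j. A' i j v) :: real ^ 'n"
  have *: "((\<lambda>z. det (A z)) has_derivative
     (\<lambda>v. \<Sum>p | p permutes UNIV. of_int (sign p) *
        (\<Sum>i\<in>UNIV. A' i (p i) v * (\<Prod>j\<in>UNIV - {i}. A z $ j $ p j)))) (at z)"
    unfolding det_def
    by (intro has_derivative_sum has_derivative_mult_right has_derivative_prod d)
  have row: "det (\<chi> r. if r = i then ?r v i else A z $ r)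
      = (\<Sum>j\<in>UNIV. A' i j v * H $ j $ i) * det (A z)" for i v
  proof -
    \<comment> \<open>Coefficients of the differentiated row with respect to the rows of
      \<open>A z\<close>: since H inverts \<open>A z\<close>, combining the rows with weights x
      gives the differentiated row back.\<close>
    define x where "x = ?r v i v* H"
    have "x v* A z = ?r v i v* (H ** A z)"
      by (simp add: x_def vector_matrix_mul_assoc)
    then have x: "x v* A z = ?r v i" by (simp add: inv)
    have "(\<Sum>k\<in>UNIV. x $ k *s row k (A z)) = ?r v i"
      unfolding x[symmetric] by (simp add: vec_eq_iff vector_matrix_mult_def row_def mult.commute)
    then have "det (\<chi> r. if r = i then ?r v i else row r (A z)) = x $ i * det (A z)"
      using cramer_lemma_transpose[where k = i and x = x and A = "A z"] by (simp only:)
    moreover have "row r (A z) = A z $ r" for r by (simp add: row_def vec_eq_iff)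
    ultimately have "det (\<chi> r. if r = i then ?r v i else A z $ r) = x $ i * det (A z)"
      by (simp only:)
    then show ?thesis by (simp add: x_def vector_matrix_mult_def mult.commute)
  qed
  have "(\<Sum>p | p permutes UNIV. of_int (sign p) *
        (\<Sum>i\<in>UNIV. A' i (p i) v * (\<Prod>j\<in>UNIV - {i}. A z $ j $ p j)))
     = (\<Sum>i\<in>UNIV. det (\<chi> r. if r = i then ?r v i else A z $ r))" for v
    unfolding det_update_row sum_distrib_left by (subst sum.swap) simp
  with * show ?thesis
    by (simp add: row sum_distrib_left mult.commute)
qed

lemma smooth_on_det:
  fixes A :: "'a::real_normed_vector \<Rightarrow> real ^ 'n::finite ^ 'n"
  assumes "open S" "\<And>i j. smooth_on S (\<lambda>z. A z $ i $ j)"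
  shows "smooth_on S (\<lambda>z. det (A z))"
  unfolding det_def
  by (intro smooth_on_sum smooth_on_mult smooth_on_prod smooth_on_const assms)

lemma matrix_inv_mult:
  fixes A :: "real ^ 'n::finite ^ 'n"
  assumes "invertible A"
  shows "A ** matrix_inv A = mat 1" "matrix_inv A ** A = mat 1"
  using someI_ex[OF assms[unfolded invertible_def]] by (auto simp: matrix_inv_def)

text \<open>\<open>matrix_inv\<close> is defined by choice. As a quotient of determinants its
  entries are seen to depend smoothly on the matrix.\<close>

lemma matrix_inv_cramer:
  fixes A :: "real ^ 'n::finite ^ 'n"
  assumes "invertible A"
  shows "matrix_inv A $ k $ l
    = det (\<chi> i j. if j = k then axis l 1 $ i else A $ i $ j) * inverse (det A)"
proof -
  have "A *v (matrix_inv A *v axis l 1) = axis l 1"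
    using matrix_inv_mult(1)[OF assms] by (simp add: matrix_vector_mul_assoc)
  then have "matrix_inv A *v axis l 1 = (\<chi> k. det (\<chi> i j. if j = k then axis l 1 $ i else A $ i $ j) / det A)"
    using cramer[of A] assms invertible_det_nz by blast
  moreover have "(matrix_inv A *v axis l 1) $ k = matrix_inv A $ k $ l"
    by (simp add: matrix_vector_mult_basis column_def)
  ultimately show ?thesis by (simp add: field_simps)
qed

lemma smooth_on_matrix_inv:
  fixes A :: "'a::real_normed_vector \<Rightarrow> real ^ 'n::finite ^ 'n"
  assumes "open S" "\<And>i j. smooth_on S (\<lambda>z. A z $ i $ j)" "\<And>z. z \<in> S \<Longrightarrow> invertible (A z)"
  shows "smooth_on S (\<lambda>z. matrix_inv (A z) $ k $ l)"
proof (rule smooth_on_cong[OF assms(1)])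
  have e: "smooth_on S (\<lambda>z. (\<chi> i j. if j = k then axis l 1 $ i else A z $ i $ j) $ i $ j)" for i j
    by (cases "j = k") (auto intro: smooth_on_const assms)
  show "smooth_on S (\<lambda>z. det (\<chi> i j. if j = k then axis l 1 $ i else A z $ i $ j) * inverse (det (A z)))"
    using assms(3) invertible_det_nz
    by (intro smooth_on_mult smooth_on_inverse smooth_on_det assms(1,2) e) auto
qed (simp add: matrix_inv_cramer assms(3))

section \<open>Integrals of derivatives\<close>

lemma integral_translate:
  fixes \<phi> :: "'a::euclidean_space \<Rightarrow> real"
  assumes "integrable lborel \<phi>"
  shows "integrable lborel (\<lambda>y. \<phi> (c + y))" "integral\<^sup>L lborel (\<lambda>y. \<phi> (c + y)) = integral\<^sup>L lborel \<phi>"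
proof -
  have m: "(+) c \<in> measurable lborel borel" by simp
  have "integrable (distr lborel borel ((+) c)) \<phi>"
    using assms by (simp add: lborel_distr_plus)
  then show "integrable lborel (\<lambda>y. \<phi> (c + y))"
    using integrable_distr[OF m] by blast
  have "\<phi> \<in> borel_measurable borel" using borel_measurable_integrable[OF assms] by simp
  from integral_distr[OF m this] show "integral\<^sup>L lborel (\<lambda>y. \<phi> (c + y)) = integral\<^sup>L lborel \<phi>"
    by (simp add: lborel_distr_plus)
qed

lemma integrable_compact_support:
  fixes \<phi> :: "'a::euclidean_space \<Rightarrow> real"
  assumes "continuous_on UNIV \<phi>" "\<And>y. norm y > R \<Longrightarrow> \<phi> y = 0"
  shows "integrable lborel \<phi>"
proof -
  have "integrable lborel (\<lambda>y. indicator (cball 0 R) y *\<^sub>R \<phi> y)"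
    by (rule borel_integrable_compact) (auto intro: continuous_on_subset[OF assms(1)])
  moreover have "(\<lambda>y. indicator (cball 0 R) y *\<^sub>R \<phi> y) = \<phi>"
    using assms(2) by (auto simp: indicator_def fun_eq_iff)
  ultimately show ?thesis by simp
qed

text \<open>The difference quotients of \<phi> along e have integral 0 by translation invariance,
  and they converge to the derivative under a common integrable bound.\<close>

lemma integral_dir_deriv_eq_0:
  fixes \<phi> :: "'a::euclidean_space \<Rightarrow> real"
  assumes d: "\<And>y. \<phi> differentiable (at y)" and c: "continuous_on UNIV (dir_deriv e \<phi>)"
    and supp: "\<And>y. norm y > R \<Longrightarrow> \<phi> y = 0"
  shows "integrable lborel (dir_deriv e \<phi>)" "integral\<^sup>L lborel (dir_deriv e \<phi>) = 0"
proof -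
  have cont: "continuous_on UNIV \<phi>"
    using d by (simp add: continuous_at_imp_continuous_on differentiable_imp_continuous_within)
  have intphi: "integrable lborel \<phi>" by (rule integrable_compact_support[OF cont supp])
  have z: "dir_deriv e \<phi> y = 0" if "norm y > R" for y
  proof -
    have "dir_deriv e \<phi> y = dir_deriv e (\<lambda>_. 0) y"
      by (rule dir_deriv_cong[of "- cball 0 R"]) (use that supp in auto)
    then show ?thesis by simp
  qed
  show int: "integrable lborel (dir_deriv e \<phi>)"
    by (rule integrable_compact_support[OF c z])
  have "bounded (dir_deriv e \<phi> ` cball 0 R)"
    by (intro compact_imp_bounded compact_continuous_image continuous_on_subset[OF c]) auto
  then obtain L0 where L0: "\<And>y. y \<in> cball 0 R \<Longrightarrow> \<bar>dir_deriv e \<phi> y\<bar> \<le> L0"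
    unfolding bounded_iff by (metis image_eqI real_norm_def)
  \<comment> \<open>Outside the ball the derivative is 0. The maximum with 0 covers these points,
    and also an empty ball, for which \<open>L0\<close> could be negative.\<close>
  then have L: "\<bar>dir_deriv e \<phi> y\<bar> \<le> max 0 L0" for y
    using z[of y] L0[of y] by (cases "norm y \<le> R") (simp_all add: le_max_iff_disj)
  define t :: "nat \<Rightarrow> real" where "t n = inverse (real (Suc n))" for n
  have t0: "t n > 0" "t n \<le> 1" for n by (auto simp: t_def field_simps)
  define q where "q n y = (\<phi> (t n *\<^sub>R e + y) - \<phi> y) / t n" for n y
  have line: "((\<lambda>s. \<phi> (y + s *\<^sub>R e)) has_real_derivative dir_deriv e \<phi> (y + s *\<^sub>R e)) (at s)" for y s
    using dir_deriv_line[where f = \<phi> and x = y and t = s and v = e, OF d] by (simp add: has_real_derivative_iff_has_vector_derivative)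
  \<comment> \<open>The quotients live in the ball of radius R + norm e because a step has length at
    most norm e; by the mean value theorem they obey the bound of the derivative.\<close>
  have qb: "norm (q n y) \<le> indicator (cball 0 (R + norm e)) y *\<^sub>R max 0 L0" for n y
  proof (cases "norm y \<le> R + norm e")
    case True
    obtain s where s: "\<phi> (y + t n *\<^sub>R e) - \<phi> (y + 0 *\<^sub>R e) = (t n - 0) * dir_deriv e \<phi> (y + s *\<^sub>R e)"
      using MVT2[where f = "\<lambda>s. \<phi> (y + s *\<^sub>R e)" and f' = "\<lambda>s. dir_deriv e \<phi> (y + s *\<^sub>R e)", OF t0(1)[of n]] line by blast
    then have "q n y = dir_deriv e \<phi> (y + s *\<^sub>R e)"
      using t0(1)[of n] s by (simp add: q_def add.commute)
    then show ?thesis using True L by (auto simp: indicator_def)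
  next
    case False
    have "norm y \<le> norm (t n *\<^sub>R e + y) + norm (t n *\<^sub>R e)"
      using norm_triangle_ineq4[of "t n *\<^sub>R e + y" "t n *\<^sub>R e"] by simp
    also have "norm (t n *\<^sub>R e) \<le> norm e" using t0[of n] by (simp add: mult_left_le_one_le)
    finally have "norm (t n *\<^sub>R e + y) > R" using False by simp
    moreover have "norm y > R" using False norm_ge_zero[of e] by linarith
    ultimately show ?thesis using False by (simp add: q_def supp)
  qed
  have qlim: "(\<lambda>n. q n y) \<longlonglongrightarrow> dir_deriv e \<phi> y" for y
  proof -
    have "((\<lambda>s. (\<phi> (y + (0 + s) *\<^sub>R e) - \<phi> (y + 0 *\<^sub>R e)) / s) \<longlongrightarrow> dir_deriv e \<phi> (y + 0 *\<^sub>R e)) (at 0)"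
      using line[of y 0] unfolding DERIV_def .
    moreover have "filterlim t (at 0) sequentially"
      unfolding filterlim_at using t0 LIMSEQ_inverse_real_of_nat
      by (auto simp: t_def[abs_def])
    ultimately show ?thesis
      by (auto dest: filterlim_compose simp: q_def add.commute)
  qed
  have qi: "integral\<^sup>L lborel (q n) = 0" for n
    using integral_translate[OF intphi, of "t n *\<^sub>R e"] intphi by (simp add: q_def[abs_def])
  have "(\<lambda>n. integral\<^sup>L lborel (q n)) \<longlonglongrightarrow> integral\<^sup>L lborel (dir_deriv e \<phi>)"
  proof (rule integral_dominated_convergence[where w = "\<lambda>y. indicator (cball 0 (R + norm e)) y *\<^sub>R max 0 L0"])
    show "integrable lborel (\<lambda>y. indicator (cball 0 (R + norm e)) y *\<^sub>R max 0 L0)"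
      by (intro borel_integrable_compact) auto
    show "q n \<in> borel_measurable lborel" for n
      unfolding q_def[abs_def] using integral_translate[OF intphi, of "t n *\<^sub>R e"] intphi
      by (auto intro!: borel_measurable_divide borel_measurable_diff dest: borel_measurable_integrable)
  qed (use qlim qb int in auto)
  then show "integral\<^sup>L lborel (dir_deriv e \<phi>) = 0"
    by (simp add: qi LIMSEQ_const_iff)
qed

text \<open>The set where \<phi> is nonzero is open and has measure zero; such a set is
  empty.\<close>

lemma continuous_nonneg_integral_eq_0:
  fixes \<phi> :: "'a::euclidean_space \<Rightarrow> real"
  assumes "continuous_on UNIV \<phi>" "\<And>y. \<phi> y \<ge> 0" "integrable lborel \<phi>" "integral\<^sup>L lborel \<phi> = 0"
  shows "\<phi> y = 0"
proof (rule ccontr)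
  assume "\<phi> y \<noteq> 0"
  have "AE y in lborel. \<phi> y = 0"
    using integral_nonneg_eq_0_iff_AE[OF assms(3)] assms by simp
  then have "{y. \<phi> y \<noteq> 0} \<in> null_sets lborel"
    using AE_iff_null_sets[of "{y. \<phi> y \<noteq> 0}" lborel] borel_measurable_integrable[OF assms(3)] by simp
  then have "negligible {y. \<phi> y \<noteq> 0}"
    by (simp add: negligible_iff_null_sets null_sets_completionI)
  moreover have "open {y. \<phi> y \<noteq> 0}"
    by (intro open_Collect_neq assms continuous_on_const)
  ultimately show False using open_not_negligible \<open>\<phi> y \<noteq> 0\<close> by blast
qed

text \<open>Made for the cut-off flux, which is known to be differentiable only off the origin.
  Vanishing on a ball around 0 repairs this; the derivative at 0 is recorded separately because the
  explicit formulas for it hold for y \<noteq> 0 only.\<close>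

lemma integral_dir_deriv_punctured:
  fixes \<phi> :: "'a::euclidean_space \<Rightarrow> real"
  assumes diff: "\<And>y. y \<noteq> 0 \<Longrightarrow> \<phi> differentiable (at y)"
    and cont: "continuous_on (- {0}) (dir_deriv e \<phi>)"
    and inner: "0 < r" "\<And>y. norm y < r \<Longrightarrow> \<phi> y = 0" and outer: "\<And>y. norm y > R \<Longrightarrow> \<phi> y = 0"
  shows "dir_deriv e \<phi> 0 = 0" "continuous_on UNIV (dir_deriv e \<phi>)"
    "integrable lborel (dir_deriv e \<phi>)" "integral\<^sup>L lborel (dir_deriv e \<phi>) = 0"
proof -
  have near: "(\<phi> has_derivative (\<lambda>v. 0)) (at y)" if "norm y < r" for y
  proof -
    have "((\<lambda>_. 0 :: real) has_derivative (\<lambda>v. 0)) (at y)" by simp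
    then show ?thesis
      by (rule has_derivative_transform_within_open[where s = "ball 0 r"]) (use that inner in auto)
  qed
  then have zero: "dir_deriv e \<phi> y = 0" if "norm y < r" for y
    using dir_derivI that by metis
  then show "dir_deriv e \<phi> 0 = 0" using inner by simp
  have d: "\<phi> differentiable (at y)" for y
    using diff[of y] near[of y] inner(1) by (cases "y = 0") (auto simp: differentiable_def)
  have "continuous_on (ball 0 r) (dir_deriv e \<phi>)"
    using zero by (subst continuous_on_cong[OF refl, of _ _ "\<lambda>_. 0"]) auto
  then have "continuous_on (ball 0 r \<union> - {0}) (dir_deriv e \<phi>)"
    using cont by (intro continuous_on_open_Un) auto
  moreover have "ball 0 r \<union> - {0} = (UNIV :: 'a set)" using inner(1) by auto
  ultimately show c: "continuous_on UNIV (dir_deriv e \<phi>)" by simp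
  show "integrable lborel (dir_deriv e \<phi>)" "integral\<^sup>L lborel (dir_deriv e \<phi>) = 0"
    by (rule integral_dir_deriv_eq_0[OF d c outer]; assumption)+
qed

text \<open>Squaring makes the positive part C^1, enough for a cutoff that is differentiated
  once.\<close>

lemma DERIV_max_0_square: "((\<lambda>t::real. (max 0 t)\<^sup>2) has_real_derivative 2 * max 0 t) (at t)"
proof (cases t "0 :: real" rule: linorder_cases)
  case less
  have "((\<lambda>t::real. 0) has_real_derivative 0) (at t)" by simp
  then have "((\<lambda>t::real. (max 0 t)\<^sup>2) has_real_derivative 0) (at t)"
    by (rule has_field_derivative_transform_within_open[where S = "{..<0}"]) (use less in auto)
  then show ?thesis using less by simp
next
  case greater
  have "((\<lambda>t::real. t\<^sup>2) has_real_derivative 2 * t) (at t)"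
    by (auto intro!: derivative_eq_intros)
  then have "((\<lambda>t::real. (max 0 t)\<^sup>2) has_real_derivative 2 * t) (at t)"
    by (rule has_field_derivative_transform_within_open[where S = "{0<..}"]) (use greater in auto)
  then show ?thesis using greater by simp
next
  case equal
  have "((\<lambda>s::real. max 0 s) \<longlongrightarrow> max 0 0) (at 0)" by (intro tendsto_intros)
  \<comment> \<open>At 0 the difference quotient is the positive part itself; division by 0 yields
    0, so this holds for s = 0 too.\<close>
  moreover have "max 0 s = (max 0 s)\<^sup>2 / s" for s :: real
    by (cases "s > 0") (auto simp: power2_eq_square max_def)
  ultimately show ?thesis using equal by (simp add: DERIV_def)
qed

section \<open>Symmetric and positive tensors\<close>

lemma sum_axis_mult [simp]:
  fixes a :: "'n::finite \<Rightarrow> real"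
  shows "(\<Sum>i\<in>UNIV. axis k 1 $ i * a i) = a k" "(\<Sum>i\<in>UNIV. a i * axis k 1 $ i) = a k"
proof -
  have "axis k 1 $ i * a i = (if i = k then a i else 0)" for i by (simp add: axis_def)
  then show "(\<Sum>i\<in>UNIV. axis k 1 $ i * a i) = a k" by simp
  then show "(\<Sum>i\<in>UNIV. a i * axis k 1 $ i) = a k" by (simp add: mult.commute)
qed

lemma sum_delta_mult [simp]:
  fixes a :: "'n::finite \<Rightarrow> real"
  shows "(\<Sum>i\<in>UNIV. (if k = i then 1 else 0) * a i) = a k"
    "(\<Sum>i\<in>UNIV. (if i = k then 1 else 0) * a i) = a k"
proof -
  have "(if k = i then 1 else 0) * a i = (if i = k then a i else 0)" for i by simp
  then show "(\<Sum>i\<in>UNIV. (if k = i then 1 else 0) * a i) = a k" by simp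
  then show "(\<Sum>i\<in>UNIV. (if i = k then 1 else 0) * a i) = a k" by (simp add: eq_commute)
qed

lemma sum_rotate:
  "(\<Sum>k\<in>A. \<Sum>l\<in>B. \<Sum>b\<in>C. p k l b) = (\<Sum>b\<in>C. \<Sum>k\<in>A. \<Sum>l\<in>B. p k l b)"
proof -
  have "(\<Sum>k\<in>A. \<Sum>l\<in>B. \<Sum>b\<in>C. p k l b) = (\<Sum>k\<in>A. \<Sum>b\<in>C. \<Sum>l\<in>B. p k l b)"
    by (rule sum.cong[OF refl]) (rule sum.swap)
  also have "\<dots> = (\<Sum>b\<in>C. \<Sum>k\<in>A. \<Sum>l\<in>B. p k l b)" by (rule sum.swap)
  finally show ?thesis .
qed

lemma sum_swap_pairs:
  "(\<Sum>k\<in>A. \<Sum>l\<in>B. \<Sum>a\<in>C. \<Sum>b\<in>D. p k l a b) = (\<Sum>a\<in>C. \<Sum>b\<in>D. \<Sum>k\<in>A. \<Sum>l\<in>B. p k l a b)"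
proof -
  have "(\<Sum>k\<in>A. \<Sum>l\<in>B. \<Sum>a\<in>C. \<Sum>b\<in>D. p k l a b) = (\<Sum>a\<in>C. \<Sum>k\<in>A. \<Sum>l\<in>B. \<Sum>b\<in>D. p k l a b)"
    by (rule sum_rotate)
  also have "\<dots> = (\<Sum>a\<in>C. \<Sum>b\<in>D. \<Sum>k\<in>A. \<Sum>l\<in>B. p k l a b)"
    by (rule sum.cong[OF refl]) (rule sum_rotate)
  finally show ?thesis .
qed

definition quad :: "('n::finite \<Rightarrow> 'n \<Rightarrow> real) \<Rightarrow> ('n \<Rightarrow> real) \<Rightarrow> real" where
  "quad H v = (\<Sum>i\<in>UNIV. \<Sum>j\<in>UNIV. v i * v j * H i j)"

text \<open>The form on a line in a coordinate direction is a quadratic polynomial in t; each use of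
  positivity in the elimination below is a choice of t.\<close>

lemma quad_add:
  assumes "\<And>i j. H i j = H j i"
  shows "quad H (\<lambda>i. v i + t * (if i = a then 1 else 0))
    = quad H v + 2 * t * (\<Sum>i\<in>UNIV. v i * H i a) + t\<^sup>2 * H a a"
proof -
  let ?e = "\<lambda>i. if i = a then 1 else (0::real)"
  have e: "(\<Sum>j\<in>UNIV. ?e j * H i j) = H i a" "(\<Sum>i\<in>UNIV. ?e i * H i j) = H j a" for i j
    using assms[of a j] by (simp_all only: sum_delta_mult)
  have "(\<Sum>i\<in>UNIV. \<Sum>j\<in>UNIV. v i * (t * ?e j) * H i j) = t * (\<Sum>i\<in>UNIV. v i * H i a)"
    unfolding e(1)[symmetric] by (simp only: sum_distrib_left mult_ac)
  moreover have "(\<Sum>i\<in>UNIV. \<Sum>j\<in>UNIV. t * ?e i * v j * H i j) = t * (\<Sum>j\<in>UNIV. v j * H j a)"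
    unfolding e(2)[symmetric] by (subst sum.swap) (simp only: sum_distrib_left mult_ac)
  moreover have "(\<Sum>i\<in>UNIV. \<Sum>j\<in>UNIV. t * ?e i * (t * ?e j) * H i j) = t\<^sup>2 * H a a"
  proof -
    have "(\<Sum>i\<in>UNIV. \<Sum>j\<in>UNIV. t * ?e i * (t * ?e j) * H i j)
        = t\<^sup>2 * (\<Sum>i\<in>UNIV. ?e i * (\<Sum>j\<in>UNIV. ?e j * H i j))"
      by (simp only: sum_distrib_left mult_ac power2_eq_square)
    then show ?thesis by (simp only: e)
  qed
  moreover have "quad H (\<lambda>i. v i + t * ?e i) = quad H v
      + (\<Sum>i\<in>UNIV. \<Sum>j\<in>UNIV. v i * (t * ?e j) * H i j)
      + (\<Sum>i\<in>UNIV. \<Sum>j\<in>UNIV. t * ?e i * v j * H i j)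
      + (\<Sum>i\<in>UNIV. \<Sum>j\<in>UNIV. t * ?e i * (t * ?e j) * H i j)"
    unfolding quad_def sum.distrib[symmetric] by (simp only: distrib_left distrib_right ac_simps)
  ultimately show ?thesis by simp
qed

text \<open>Cholesky factorisation: each step kills a nonzero diagonal entry.\<close>

lemma psd_sum_of_squares:
  fixes H :: "'n::finite \<Rightarrow> 'n \<Rightarrow> real"
  assumes "\<And>i j. H i j = H j i" "\<And>v. quad H v \<ge> 0"
  shows "\<exists>(m::nat) W. \<forall>i j. H i j = (\<Sum>a<m. W a i * W a j)"
  using assms
proof (induction "card {i. H i i \<noteq> 0}" arbitrary: H rule: less_induct)
  case less
  note sym = less.prems(1) and psd = less.prems(2)
  have diag: "H a a \<ge> 0" for a
    using psd[of "\<lambda>i. 0 + 1 * (if i = a then 1 else 0)"] unfolding quad_add[OF sym]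
    by (simp add: quad_def)
  have off: "H b a = 0" if "H a a = 0" for a b
  proof (rule ccontr)
    assume ne: "H b a \<noteq> 0"
    \<comment> \<open>On e_b + t e_a the form is \<open>H b b + 2 * t * H b a\<close>, affine in t
      because \<open>H a a = 0\<close>; this t gives it the value -1.\<close>
    define t where "t = - (H b b + 1) / (2 * H b a)"
    have "(\<Sum>i\<in>UNIV. (0 + 1 * (if i = b then 1 else 0)) * H i a) = H b a"
      by (simp only: mult_1 add_0 sum_delta_mult)
    moreover have "quad H (\<lambda>i. 0 + 1 * (if i = b then 1 else 0)) = H b b"
      unfolding quad_add[OF sym] by (simp add: quad_def)
    ultimately have "H b b + 2 * t * H b a \<ge> 0"
      using psd[of "\<lambda>i. (0 + 1 * (if i = b then 1 else 0)) + t * (if i = a then 1 else 0)"] that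
      unfolding quad_add[where v = "\<lambda>i. 0 + 1 * (if i = b then 1 else 0)", OF sym] by simp
    moreover have "2 * t * H b a = - (H b b + 1)" using ne by (simp add: t_def)
    ultimately show False by linarith
  qed
  show ?case
  proof (cases "\<exists>a. H a a \<noteq> 0")
    case False
    then show ?thesis using off by (intro exI[of _ 0]) auto
  next
    case True
    then obtain a where a: "H a a \<noteq> 0" by blast
    with diag[of a] have pos: "H a a > 0" by simp
    define H' where "H' i j = H i j - H i a * H j a / H a a" for i j
    have "quad H' v \<ge> 0" for v
    proof -
      define s where "s = (\<Sum>i\<in>UNIV. v i * H i a)"
      have "(\<Sum>i\<in>UNIV. \<Sum>j\<in>UNIV. v i * v j * (H i a * H j a / H a a)) = s * s / H a a"
        unfolding s_def sum_product sum_divide_distrib by (simp add: mult_ac)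
      then have "quad H' v = quad H v - s * s / H a a"
        by (simp add: quad_def H'_def right_diff_distrib sum_subtractf)
      \<comment> \<open>The shift by - s / H a a minimises the form on the line v + t e_a, and the
        minimum is the value of \<open>H'\<close> at v.\<close>
      moreover have "quad H (\<lambda>i. v i + (- s / H a a) * (if i = a then 1 else 0)) \<ge> 0"
        by (rule psd)
      then have "quad H v + 2 * (- s / H a a) * s + (- s / H a a)\<^sup>2 * H a a \<ge> 0"
        unfolding quad_add[OF sym] s_def[symmetric] .
      then have "quad H v - s * s / H a a \<ge> 0" using a by (simp add: power2_eq_square field_simps)
      ultimately show ?thesis by simp
    qed
    moreover have "H' i j = H' j i" for i j by (simp add: H'_def sym[of i j])
    moreover have "{i. H' i i \<noteq> 0} \<subset> {i. H i i \<noteq> 0}"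
    proof -
      have "H' a a = 0" using a by (simp add: H'_def)
      moreover have "H' i i = 0" if "H i i = 0" for i
        using off[OF that, of a] that sym[of i a] by (simp add: H'_def)
      ultimately show ?thesis using a by blast
    qed
    then have "card {i. H' i i \<noteq> 0} < card {i. H i i \<noteq> 0}" by (intro psubset_card_mono) auto
    ultimately obtain m :: nat and W where W: "\<And>i j. H' i j = (\<Sum>b<m. W b i * W b j)"
      using less.hyps[of H'] by blast
    have "H i j = (\<Sum>b<Suc m. (W(m := \<lambda>i. H i a / sqrt (H a a))) b i * (W(m := \<lambda>i. H i a / sqrt (H a a))) b j)" for i j
      using W[of i j, symmetric] pos by (simp add: H'_def)
    then show ?thesis by blast
  qed
qed

text \<open>Writing H as the sum of the squares W_a W_a^T turns the contraction of V with M into the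
  sum of the squares of p a b = W_a^T M W_b. If it is 0, all p a b vanish, and V is a combination of
  them.\<close>

lemma trace_square_psd:
  fixes H :: "'n::finite \<Rightarrow> 'n \<Rightarrow> real"
  assumes "\<And>i j. H i j = H j i" "\<And>v. quad H v \<ge> 0"
    and V: "\<And>i j. V i j = (\<Sum>k\<in>UNIV. \<Sum>l\<in>UNIV. H i k * H j l * M k l)"
  shows "(\<Sum>i\<in>UNIV. \<Sum>j\<in>UNIV. V i j * M i j) \<ge> 0"
    and "(\<Sum>i\<in>UNIV. \<Sum>j\<in>UNIV. V i j * M i j) = 0 \<Longrightarrow> V i j = 0"
proof -
  obtain m :: nat and W where W: "\<And>i j. H i j = (\<Sum>a<m. W a i * W a j)"
    using psd_sum_of_squares[OF assms(1,2)] by blast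
  define p where "p a b = (\<Sum>k\<in>UNIV. \<Sum>l\<in>UNIV. W a k * W b l * M k l)" for a b
  have Vp: "V i j = (\<Sum>a<m. \<Sum>b<m. W a i * W b j * p a b)" for i j
  proof -
    have "H i k * H j l * M k l = (\<Sum>a<m. \<Sum>b<m. W a i * W b j * (W a k * W b l * M k l))" for k l
    proof -
      have "H i k * H j l = (\<Sum>a<m. \<Sum>b<m. (W a i * W a k) * (W b j * W b l))"
        unfolding W by (rule sum_product)
      then show ?thesis by (simp add: sum_distrib_left sum_distrib_right mult_ac)
    qed
    then show ?thesis unfolding V p_def sum_distrib_left by (simp only: sum_swap_pairs[of _ UNIV UNIV])
  qed
  have "(\<Sum>i\<in>UNIV. \<Sum>j\<in>UNIV. V i j * M i j)
      = (\<Sum>a<m. \<Sum>b<m. \<Sum>i\<in>UNIV. \<Sum>j\<in>UNIV. W a i * W b j * p a b * M i j)"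
    unfolding Vp sum_distrib_right by (rule sum_swap_pairs)
  also have "\<dots> = (\<Sum>a<m. \<Sum>b<m. p a b * p a b)"
    by (subst (2) p_def) (simp add: sum_distrib_left mult_ac)
  finally have eq: "(\<Sum>i\<in>UNIV. \<Sum>j\<in>UNIV. V i j * M i j) = (\<Sum>a<m. \<Sum>b<m. p a b * p a b)" .
  show "(\<Sum>i\<in>UNIV. \<Sum>j\<in>UNIV. V i j * M i j) \<ge> 0" unfolding eq by (intro sum_nonneg) simp
  show "V i j = 0" if "(\<Sum>i\<in>UNIV. \<Sum>j\<in>UNIV. V i j * M i j) = 0"
  proof -
    have "\<forall>a\<in>{..<m}. (\<Sum>b<m. p a b * p a b) = 0"
      using that unfolding eq by (subst (asm) sum_nonneg_eq_0_iff) (auto intro: sum_nonneg)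
    then have "p a b = 0" if "a < m" "b < m" for a b
      using that by (subst (asm) sum_nonneg_eq_0_iff) auto
    then show ?thesis unfolding Vp by (intro sum.neutral ballI) simp
  qed
qed

text \<open>Every matrix on the segment from the identity to A is positive definite, hence
  invertible, so the determinant cannot change sign along it.\<close>

lemma det_pos_of_positive_definite:
  fixes A :: "real ^ 'n::finite ^ 'n"
  assumes pos: "\<And>v. v \<noteq> 0 \<Longrightarrow> v \<bullet> (A *v v) > 0"
  shows "det A > 0"
proof (rule ccontr)
  assume neg: "\<not> det A > 0"
  define P where "P t = (1 - t) *\<^sub>R mat 1 + t *\<^sub>R A" for t :: real
  have nz: "det (P t) \<noteq> 0" if "0 \<le> t" "t \<le> 1" for t
  proof -
    have "v \<bullet> (P t *v v) > 0" if "v \<noteq> 0" for v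
    proof -
      have "v \<bullet> (P t *v v) = (1 - t) * (v \<bullet> v) + t * (v \<bullet> (A *v v))"
        by (simp add: P_def matrix_vector_mult_add_rdistrib scaleR_matrix_vector_assoc[symmetric] inner_add_right)
      moreover have "v \<bullet> v > 0" "v \<bullet> (A *v v) > 0" using pos \<open>v \<noteq> 0\<close> by auto
      ultimately show ?thesis using \<open>0 \<le> t\<close> \<open>t \<le> 1\<close>
        by (cases "t = 0") (auto intro: add_nonneg_pos)
    qed
    then have "\<forall>v. P t *v v = 0 \<longrightarrow> v = 0" by (metis inner_zero_right less_irrefl)
    then show ?thesis
      using invertible_det_nz matrix_left_invertible_ker invertible_left_inverse by blast
  qed
  have "continuous_on {0..1} (\<lambda>t. det (P t))"
    unfolding det_def P_def by (intro continuous_intros)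
  then have "\<exists>t\<ge>0. t \<le> 1 \<and> det (P t) = 0"
    using neg by (intro IVT2') (auto simp: P_def)
  then show False using nz by blast
qed

text \<open>The argument behind the uniqueness of a torsion-free metric connection: six alternating
  exchanges restore the order of the indices and collect three signs.\<close>

lemma symmetric_skew_eq_0:
  fixes t :: "'i \<Rightarrow> 'i \<Rightarrow> 'i \<Rightarrow> real"
  assumes "\<And>a b c. t a b c = t a c b" "\<And>a b c. t a b c = - t b a c"
  shows "t a b c = 0"
proof -
  have "t a b c = - t b a c" "t b a c = t b c a" "t b c a = - t c b a" "t c b a = t c a b"
    "t c a b = - t a c b" "t a c b = t a b c" using assms by blast+
  then show ?thesis by linarith
qed

section \<open>Local Finsler geometry\<close>

lemma pdx_dir_deriv: "pdx k a = dir_deriv (axis k 1, 0) a"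
  by (simp add: fun_eq_iff pdx_def dir_deriv_def)

lemma pdy_dir_deriv: "pdy k a = dir_deriv (0, axis k 1) a"
  by (simp add: fun_eq_iff pdy_def dir_deriv_def)

lemma pair_expand_axis:
  fixes v :: "(real ^ 'n::finite) \<times> (real ^ 'n)"
  shows "v = (\<Sum>i\<in>UNIV. fst v $ i *\<^sub>R (axis i 1, 0)) + (\<Sum>i\<in>UNIV. snd v $ i *\<^sub>R (0, axis i 1))"
  by (rule prod_eqI) (simp_all add: fst_sum snd_sum scalar_mult_eq_scaleR[symmetric] basis_expansion)

lemma dir_deriv_expand:
  fixes a :: "(real ^ 'n::finite) \<times> (real ^ 'n) \<Rightarrow> real"
  assumes "a differentiable (at z)"
  shows "dir_deriv v a z = (\<Sum>i\<in>UNIV. fst v $ i * dir_deriv (axis i 1, 0) a z)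
    + (\<Sum>i\<in>UNIV. snd v $ i * dir_deriv (0, axis i 1) a z)"
proof -
  interpret linear "\<lambda>v. dir_deriv v a z" by (rule dir_deriv_linear[OF assms])
  show ?thesis by (subst pair_expand_axis[of v]) (simp add: add sum scale del: scaleR_Pair)
qed

lemma dir_deriv_snd [simp]: "dir_deriv v (\<lambda>w. snd w $ i) z = snd v $ i"
  by (rule dir_derivI[where f' = "\<lambda>v. snd v $ i"])
    (intro bounded_linear_imp_has_derivative bounded_linear_compose[OF bounded_linear_vec_nth bounded_linear_snd])

text \<open>A Finsler structure seen in one chart. \<open>hom_F\<close> includes y = 0, which forces
  F to vanish on the zero section.\<close>

locale finsler_chart =
  fixes U :: "(real ^ 'n::finite) set" and F :: "(real ^ 'n) \<times> (real ^ 'n) \<Rightarrow> real"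
  assumes open_U: "open U"
    and smooth_F: "smooth_on (U \<times> - {0}) F"
    and hom_F: "\<And>x y t. x \<in> U \<Longrightarrow> t > 0 \<Longrightarrow> F (x, t *\<^sub>R y) = t * F (x, y)"
    and pos_F: "\<And>z v. z \<in> U \<times> - {0} \<Longrightarrow> v \<noteq> 0 \<Longrightarrow> v \<bullet> (fundamental_tensor F z *v v) > 0"
begin

definition S :: "((real ^ 'n) \<times> (real ^ 'n)) set" where "S = U \<times> - {0}"

abbreviation smooth :: "((real ^ 'n) \<times> (real ^ 'n) \<Rightarrow> real) \<Rightarrow> bool" where
  "smooth \<equiv> smooth_on S"

abbreviation X :: "'n \<Rightarrow> ((real ^ 'n) \<times> (real ^ 'n) \<Rightarrow> real) \<Rightarrow> (real ^ 'n) \<times> (real ^ 'n) \<Rightarrow> real" where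
  "X k \<equiv> dir_deriv (axis k 1, 0)"

abbreviation Y :: "'n \<Rightarrow> ((real ^ 'n) \<times> (real ^ 'n) \<Rightarrow> real) \<Rightarrow> (real ^ 'n) \<times> (real ^ 'n) \<Rightarrow> real" where
  "Y k \<equiv> dir_deriv (0, axis k 1)"

lemma open_S: "open S"
  unfolding S_def by (intro open_Times open_U) auto

lemma smooth_snd [simp]: "smooth (\<lambda>w. snd w $ i)"
  by (rule smooth_on_linear)
    (intro bounded_linear_compose[OF bounded_linear_vec_nth bounded_linear_snd])

lemma smooth_rules [simp]:
  "smooth (\<lambda>w. c)"
  "smooth a \<Longrightarrow> smooth b \<Longrightarrow> smooth (\<lambda>w. a w + b w)"
  "smooth a \<Longrightarrow> smooth b \<Longrightarrow> smooth (\<lambda>w. a w - b w)"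
  "smooth a \<Longrightarrow> smooth b \<Longrightarrow> smooth (\<lambda>w. a w * b w)"
  "smooth a \<Longrightarrow> smooth (dir_deriv v a)"
  "smooth a \<Longrightarrow> smooth (\<lambda>w. a w / c)"
  unfolding divide_inverse
  by (auto intro!: smooth_on_const smooth_on_add smooth_on_diff smooth_on_mult smooth_on_dir_deriv open_S)

lemma smooth_sum [simp]: "(\<And>i. i \<in> I \<Longrightarrow> smooth (p i)) \<Longrightarrow> smooth (\<lambda>w. \<Sum>i\<in>I. p i w)"
  by (rule smooth_on_sum[OF open_S])

lemma smooth_differentiable: "smooth a \<Longrightarrow> z \<in> S \<Longrightarrow> a differentiable (at z)"
  by (rule smooth_on_differentiable)

lemma D_rules:
  assumes "z \<in> S"
  shows "smooth a \<Longrightarrow> smooth b \<Longrightarrow> dir_deriv v (\<lambda>w. a w + b w) z = dir_deriv v a z + dir_deriv v b z"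
  "smooth a \<Longrightarrow> smooth b \<Longrightarrow> dir_deriv v (\<lambda>w. a w - b w) z = dir_deriv v a z - dir_deriv v b z"
  "smooth a \<Longrightarrow> smooth b \<Longrightarrow> dir_deriv v (\<lambda>w. a w * b w) z = a z * dir_deriv v b z + dir_deriv v a z * b z"
  "smooth a \<Longrightarrow> dir_deriv v (\<lambda>w. a w / c) z = dir_deriv v a z / c"
  using dir_deriv_add[of a z b v] dir_deriv_diff[of a z b v] dir_deriv_mult[of a z b v]
    dir_deriv_cmult[of a z v "inverse c"] smooth_differentiable[OF _ assms]
  by (auto simp: divide_inverse mult.commute[of _ "inverse c"])

lemma D_sum:
  assumes "z \<in> S" "\<And>i. i \<in> I \<Longrightarrow> smooth (p i)"
  shows "dir_deriv v (\<lambda>w. \<Sum>i\<in>I. p i w) z = (\<Sum>i\<in>I. dir_deriv v (p i) z)"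
  using assms by (intro dir_deriv_sum smooth_differentiable) auto

lemma D_cong:
  assumes "\<And>w. w \<in> S \<Longrightarrow> a w = b w" "z \<in> S"
  shows "dir_deriv v a z = dir_deriv v b z"
  using dir_deriv_cong[OF open_S] assms by blast

lemma D_commute: "smooth a \<Longrightarrow> z \<in> S \<Longrightarrow> dir_deriv v (dir_deriv w a) z = dir_deriv w (dir_deriv v a) z"
  by (rule dir_deriv_commute[OF open_S])

lemma D_commute3:
  assumes "smooth a" "z \<in> S"
  shows "dir_deriv v (dir_deriv w (dir_deriv u a)) z = dir_deriv u (dir_deriv v (dir_deriv w a)) z"
  using D_cong[OF D_commute[OF assms(1), of _ w u] assms(2)] D_commute[OF smooth_rules(5)[OF assms(1)] assms(2)]
  by simp

lemma D_vertical: "smooth a \<Longrightarrow> z \<in> S \<Longrightarrow> dir_deriv (0, b) a z = (\<Sum>i\<in>UNIV. b $ i * Y i a z)"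
  by (subst dir_deriv_expand) (auto intro: smooth_differentiable)

text \<open>Positive homogeneity of degree \<open>r\<close> in \<open>y\<close>, encoded by Euler's differential equation.\<close>

definition homog :: "real \<Rightarrow> ((real ^ 'n) \<times> (real ^ 'n) \<Rightarrow> real) \<Rightarrow> bool" where
  "homog r a \<longleftrightarrow> smooth a \<and> (\<forall>z\<in>S. dir_deriv (0, snd z) a z = r * a z)"

lemma homog_euler: "homog r a \<Longrightarrow> z \<in> S \<Longrightarrow> (\<Sum>i\<in>UNIV. snd z $ i * Y i a z) = r * a z"
  using D_vertical[of a z "snd z"] by (auto simp: homog_def)

text \<open>Euler's equation differentiated along v. The second sum comes from differentiating y: it
  is 0 in the direction of x^k and \<open>Y k a\<close> in the direction of y^k, whence
  \<open>X k\<close> keeps the degree and \<open>Y k\<close> lowers it by one.\<close>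

lemma homog_euler_deriv:
  assumes "homog r a" "z \<in> S"
  shows "(\<Sum>i\<in>UNIV. snd z $ i * dir_deriv v (Y i a) z) + (\<Sum>i\<in>UNIV. snd v $ i * Y i a z)
    = r * dir_deriv v a z"
proof -
  have sm: "smooth a" using assms(1) by (simp add: homog_def)
  have "dir_deriv v (\<lambda>w. \<Sum>i\<in>UNIV. snd w $ i * Y i a w) z = dir_deriv v (\<lambda>w. r * a w) z"
    by (rule D_cong[OF homog_euler[OF assms(1)] assms(2)])
  then show ?thesis using sm assms(2) by (simp add: D_rules D_sum sum.distrib)
qed

lemma homog_X:
  assumes "homog r a"
  shows "homog r (X k a)"
  unfolding homog_def
proof (intro conjI ballI)
  have sm: "smooth a" using assms(1) by (simp add: homog_def)
  then show "smooth (X k a)" by simp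
  show "dir_deriv (0, snd z) (X k a) z = r * X k a z" if "z \<in> S" for z
    using homog_euler_deriv[OF assms that, of "(axis k 1, 0)"] that sm
    by (simp add: D_vertical[of _ z "snd z"] D_commute[of a z "(axis k 1, 0)"])
qed

lemma homog_Y:
  assumes "homog r a"
  shows "homog (r - 1) (Y k a)"
  unfolding homog_def
proof (intro conjI ballI)
  have sm: "smooth a" using assms(1) by (simp add: homog_def)
  then show "smooth (Y k a)" by simp
  show "dir_deriv (0, snd z) (Y k a) z = (r - 1) * Y k a z" if "z \<in> S" for z
    using homog_euler_deriv[OF assms that, of "(0, axis k 1)"] that sm
    by (simp add: D_vertical[of _ z "snd z"] D_commute[of a z "(0, axis k 1)"] algebra_simps)
qed

lemma homog_mult:
  "homog r a \<Longrightarrow> homog s b \<Longrightarrow> homog (r + s) (\<lambda>w. a w * b w)"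
  by (auto simp: homog_def D_rules algebra_simps)

lemma homog_divide: "homog r a \<Longrightarrow> homog r (\<lambda>w. a w / c)"
  by (auto simp: homog_def D_rules)

lemma homog_diff: "homog r a \<Longrightarrow> homog r b \<Longrightarrow> homog r (\<lambda>w. a w - b w)"
  by (auto simp: homog_def D_rules algebra_simps)

lemma homog_sum: "(\<And>i. i \<in> I \<Longrightarrow> homog r (p i)) \<Longrightarrow> homog r (\<lambda>w. \<Sum>i\<in>I. p i w)"
  by (auto simp: homog_def D_sum sum_distrib_left)

lemma homog_snd: "homog 1 (\<lambda>w. snd w $ i)"
  by (simp add: homog_def)

section \<open>The fundamental tensor and its inverse\<close>

definition f where "f w = (F w)\<^sup>2"

lemma f_eq: "(\<lambda>w. (F w)\<^sup>2) = f"
  by (simp add: fun_eq_iff f_def)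

lemma smooth_f [simp]: "smooth f"
  using smooth_on_mult[OF open_S smooth_F[folded S_def] smooth_F[folded S_def]]
  by (simp add: f_def[abs_def] power2_eq_square)

lemma f_scale: "x \<in> U \<Longrightarrow> t > 0 \<Longrightarrow> f (x, t *\<^sub>R y) = t\<^sup>2 * f (x, y)"
  by (simp add: f_def hom_F power_mult_distrib)

lemma homog_f: "homog 2 f"
  unfolding homog_def
proof (intro conjI ballI)
  fix z assume z: "z \<in> S"
  obtain x y where xy: "z = (x, y)" "x \<in> U" using z by (auto simp: S_def)
  have "((\<lambda>t. f (z + t *\<^sub>R (0, y))) has_vector_derivative dir_deriv (0, y) f (z + 0 *\<^sub>R (0, y))) (at 0)"
    by (rule dir_deriv_line) (use smooth_differentiable[OF smooth_f z] in \<open>simp add: zero_prod_def[symmetric]\<close>)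
  moreover have "((\<lambda>t. f (z + t *\<^sub>R (0, y))) has_vector_derivative 2 * f z) (at 0)"
  proof (rule has_vector_derivative_transform_within_open[where f = "\<lambda>t. (1 + t)\<^sup>2 * f z" and S = "{-1<..}"])
    show "((\<lambda>t. (1 + t)\<^sup>2 * f z) has_vector_derivative 2 * f z) (at 0)"
      unfolding has_real_derivative_iff_has_vector_derivative[symmetric]
      by (auto intro!: derivative_eq_intros)
    show "(1 + t)\<^sup>2 * f z = f (z + t *\<^sub>R (0, y))" if "t \<in> {-1<..}" for t
      using f_scale[of x "1 + t" y] that xy by (simp add: scaleR_left.add)
  qed auto
  ultimately show "dir_deriv (0, snd z) f z = 2 * f z"
    using vector_derivative_unique_at xy by fastforce
qed simp

definition g where "g i j w = fundamental_tensor F w $ i $ j"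
definition h where "h i j w = matrix_inv (fundamental_tensor F w) $ i $ j"

lemma g_eq: "g i j = (\<lambda>w. Y j (Y i f) w / 2)"
  by (simp add: fun_eq_iff g_def fundamental_tensor_def pdy_dir_deriv f_eq)

lemma smooth_g [simp]: "smooth (g i j)"
  by (simp add: g_eq)

lemma g_sym: "z \<in> S \<Longrightarrow> g i j z = g j i z"
  using D_commute[OF smooth_f] by (simp add: g_eq)

lemma homog_g: "homog 0 (g i j)"
  using homog_divide[OF homog_Y[OF homog_Y[OF homog_f]], of j i 2] by (simp add: g_eq)

lemma g_radial: "z \<in> S \<Longrightarrow> (\<Sum>j\<in>UNIV. snd z $ j * g i j z) = Y i f z / 2"
  using homog_euler[OF homog_Y[OF homog_f], of z i] by (simp add: g_eq sum_divide_distrib[symmetric])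

text \<open>Together the two identities make \<open>Y k (g i j)\<close>, the Cartan tensor up to a
  factor, totally symmetric, as a third fibre derivative of f should be.\<close>

lemma Yg_sym:
  assumes "z \<in> S"
  shows "dir_deriv v (g i j) z = dir_deriv v (g j i) z" "Y k (g i j) z = Y j (g i k) z"
proof -
  show "dir_deriv v (g i j) z = dir_deriv v (g j i) z" by (rule D_cong[OF g_sym assms])
  show "Y k (g i j) z = Y j (g i k) z"
    using D_commute[of "Y i f" z] assms by (simp add: g_eq D_rules)
qed

lemma Yg_radial: "z \<in> S \<Longrightarrow> (\<Sum>j\<in>UNIV. snd z $ j * Y m (g j l) z) = 0"
  using homog_euler[OF homog_g, of z l m] by (simp add: Yg_sym(1)[of z _ _ l] Yg_sym(2)[of z m])

lemma fundamental_tensor_invertible: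
  assumes "z \<in> S" shows "invertible (fundamental_tensor F z)"
proof -
  have "\<forall>v. fundamental_tensor F z *v v = 0 \<longrightarrow> v = 0"
    using pos_F[of z] assms by (metis S_def inner_zero_right less_irrefl)
  then show ?thesis using matrix_left_invertible_ker invertible_left_inverse by blast
qed

lemma smooth_h [simp]: "smooth (h i j)"
  unfolding h_def[abs_def]
  by (rule smooth_on_matrix_inv[OF open_S]) (auto simp: fundamental_tensor_invertible g_def[symmetric])

lemma g_h: "z \<in> S \<Longrightarrow> (\<Sum>j\<in>UNIV. g i j z * h j k z) = (if i = k then 1 else 0)"
  using arg_cong[OF matrix_inv_mult(1)[OF fundamental_tensor_invertible], of z "\<lambda>A. A $ i $ k"]
  by (simp add: matrix_matrix_mult_def g_def h_def mat_def)

lemma h_g: "z \<in> S \<Longrightarrow> (\<Sum>j\<in>UNIV. h i j z * g j k z) = (if i = k then 1 else 0)"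
  using arg_cong[OF matrix_inv_mult(2)[OF fundamental_tensor_invertible], of z "\<lambda>A. A $ i $ k"]
  by (simp add: matrix_matrix_mult_def g_def h_def mat_def)

lemma lower_raise:
  assumes "z \<in> S" shows "(\<Sum>i\<in>UNIV. g l i z * (\<Sum>m\<in>UNIV. h i m z * t m)) = t l"
proof -
  have "(\<Sum>i\<in>UNIV. g l i z * (\<Sum>m\<in>UNIV. h i m z * t m)) = (\<Sum>m\<in>UNIV. (\<Sum>i\<in>UNIV. g l i z * h i m z) * t m)"
    by (simp add: sum_distrib_left sum_distrib_right mult.assoc) (rule sum.swap)
  then show ?thesis by (simp add: g_h[OF assms])
qed

lemma raise_lower:
  assumes "z \<in> S" shows "(\<Sum>i\<in>UNIV. h l i z * (\<Sum>m\<in>UNIV. g i m z * t m)) = t l"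
proof -
  have "(\<Sum>i\<in>UNIV. h l i z * (\<Sum>m\<in>UNIV. g i m z * t m)) = (\<Sum>m\<in>UNIV. (\<Sum>i\<in>UNIV. h l i z * g i m z) * t m)"
    by (simp add: sum_distrib_left sum_distrib_right mult.assoc) (rule sum.swap)
  then show ?thesis by (simp add: h_g[OF assms])
qed

text \<open>As g is invertible, an identity with a free upper index may be checked after lowering
  that index, which removes an outer factor h.\<close>

lemma lower_cancel:
  assumes "z \<in> S" "\<And>l. (\<Sum>i\<in>UNIV. g l i z * s i) = (\<Sum>i\<in>UNIV. g l i z * t i)"
  shows "s i = t i"
  using raise_lower[OF assms(1), of i s] raise_lower[OF assms(1), of i t] assms(2) by simp

lemma h_sym:
  assumes "z \<in> S" shows "h i j z = h j i z"
proof (rule lower_cancel[OF assms, of "\<lambda>i. h i j z" "\<lambda>i. h j i z"])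
  fix l
  have "(\<Sum>i\<in>UNIV. g l i z * h j i z) = (\<Sum>i\<in>UNIV. h j i z * g i l z)"
    by (simp add: mult.commute g_sym[OF assms, of l])
  then show "(\<Sum>i\<in>UNIV. g l i z * h i j z) = (\<Sum>i\<in>UNIV. g l i z * h j i z)"
    by (simp add: g_h[OF assms] h_g[OF assms])
qed

lemma D_h:
  assumes z: "z \<in> S"
  shows "dir_deriv v (h i j) z = - (\<Sum>a\<in>UNIV. h i a z * (\<Sum>b\<in>UNIV. dir_deriv v (g a b) z * h b j z))"
proof (rule lower_cancel[OF z, of "\<lambda>i. dir_deriv v (h i j) z"
      "\<lambda>i. - (\<Sum>a\<in>UNIV. h i a z * (\<Sum>b\<in>UNIV. dir_deriv v (g a b) z * h b j z))"])
  fix l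
  have "dir_deriv v (\<lambda>w. \<Sum>i\<in>UNIV. g l i w * h i j w) z = dir_deriv v (\<lambda>w. if l = j then 1 else 0) z"
    by (rule D_cong[OF g_h z])
  then have "(\<Sum>i\<in>UNIV. g l i z * dir_deriv v (h i j) z) + (\<Sum>i\<in>UNIV. dir_deriv v (g l i) z * h i j z) = 0"
    using z by (simp add: D_rules D_sum sum.distrib)
  then show "(\<Sum>i\<in>UNIV. g l i z * dir_deriv v (h i j) z) = (\<Sum>i\<in>UNIV. g l i z *
      - (\<Sum>a\<in>UNIV. h i a z * (\<Sum>b\<in>UNIV. dir_deriv v (g a b) z * h b j z)))"
    by (simp add: sum_negf lower_raise[OF z])
qed

section \<open>Spray coefficients and the nonlinear connection\<close>

definition G where "G = spray_coeff F"
definition N where "N i j = Y j (G i)"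

lemma N_eq: "nonlinear_conn F i j z = N i j z"
  by (simp add: nonlinear_conn_def N_def pdy_dir_deriv G_def)

definition spray_rhs where "spray_rhs l w = (\<Sum>k\<in>UNIV. snd w $ k * X k (Y l f) w) - X l f w"

lemma smooth_spray_rhs [simp]: "smooth (spray_rhs l)"
  by (simp add: spray_rhs_def[abs_def])

lemma G_eq: "G i = (\<lambda>w. (\<Sum>j\<in>UNIV. h i j w * spray_rhs j w) / 4)"
  by (simp add: fun_eq_iff G_def spray_coeff_def pdx_dir_deriv pdy_dir_deriv f_eq h_def
      spray_rhs_def mult.commute)

lemma smooth_G [simp]: "smooth (G i)"
  by (simp add: G_eq)

lemma smooth_N [simp]: "smooth (N i j)"
  by (simp add: N_def)

lemma lower_G: "z \<in> S \<Longrightarrow> (\<Sum>i\<in>UNIV. g l i z * G i z) = spray_rhs l z / 4"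
  by (simp add: G_eq sum_divide_distrib[symmetric] lower_raise)

lemma homog_spray_rhs: "homog 2 (spray_rhs l)"
proof -
  have "homog (1 + (2 - 1)) (\<lambda>w. snd w $ k * X k (Y l f) w)" for k
    by (intro homog_mult homog_snd homog_X homog_Y homog_f)
  then have "homog 2 (\<lambda>w. snd w $ k * X k (Y l f) w)" for k by simp
  then show ?thesis
    unfolding spray_rhs_def[abs_def] by (intro homog_diff homog_sum homog_X homog_f)
qed

text \<open>Euler's operator is applied to \<open>lower_G\<close>: g has degree 0 and the right side
  degree 2, so the lowered spray determines the degree.\<close>

lemma homog_G: "homog 2 (G i)"
proof -
  have "dir_deriv (0, snd z) (G i) z = 2 * G i z" if z: "z \<in> S" for z i
  proof (rule lower_cancel[OF z, of "\<lambda>i. dir_deriv (0, snd z) (G i) z" "\<lambda>i. 2 * G i z"])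
    fix l
    have "dir_deriv (0, snd z) (\<lambda>w. \<Sum>i\<in>UNIV. g l i w * G i w) z
        = dir_deriv (0, snd z) (\<lambda>w. spray_rhs l w / 4) z"
      by (rule D_cong[OF lower_G z])
    moreover have "dir_deriv (0, snd z) (g l i) z = 0" for i
      using homog_g[of l i] z by (simp add: homog_def)
    moreover have "dir_deriv (0, snd z) (spray_rhs l) z = 2 * spray_rhs l z"
      using homog_spray_rhs[of l] z by (simp add: homog_def)
    ultimately have "(\<Sum>i\<in>UNIV. g l i z * dir_deriv (0, snd z) (G i) z) = spray_rhs l z / 2"
      using z by (simp add: D_rules D_sum)
    then show "(\<Sum>i\<in>UNIV. g l i z * dir_deriv (0, snd z) (G i) z) = (\<Sum>i\<in>UNIV. g l i z * (2 * G i z))"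
      using lower_G[OF z, of l] by (simp add: mult.left_commute sum_distrib_left[symmetric])
  qed
  then show ?thesis by (simp add: homog_def)
qed

lemma homog_N: "homog 1 (N i j)"
  using homog_Y[OF homog_G] by (simp add: N_def)

lemma N_radial: "z \<in> S \<Longrightarrow> (\<Sum>j\<in>UNIV. snd z $ j * N i j z) = 2 * G i z"
  using homog_euler[OF homog_G] by (simp add: N_def)

text \<open>The y^k-derivative of \<open>lower_G\<close>, arranged into an antisymmetric and a
  symmetric part in l and k; \<open>\<gamma>_radial\<close> arrives at exactly this
  expression.\<close>

lemma lower_N:
  assumes z: "z \<in> S"
  shows "(\<Sum>i\<in>UNIV. g l i z * N i k z) = (1/4) * (X k (Y l f) z - X l (Y k f) z)
    + (1/2) * (\<Sum>m\<in>UNIV. snd z $ m * X m (g l k) z) - (\<Sum>i\<in>UNIV. G i z * Y i (g l k) z)"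
proof -
  have "Y k (\<lambda>w. \<Sum>i\<in>UNIV. g l i w * G i w) z = Y k (\<lambda>w. spray_rhs l w / 4) z"
    by (rule D_cong[OF lower_G z])
  then have "(\<Sum>i\<in>UNIV. g l i z * N i k z) + (\<Sum>i\<in>UNIV. Y k (g l i) z * G i z) = Y k (spray_rhs l) z / 4"
    using z by (simp add: D_rules D_sum N_def sum.distrib)
  moreover have "Y k (spray_rhs l) z = X k (Y l f) z + (\<Sum>m\<in>UNIV. snd z $ m * Y k (X m (Y l f)) z) - Y k (X l f) z"
    using z by (simp add: spray_rhs_def[abs_def] D_rules D_sum sum.distrib)
  moreover have "(\<Sum>m\<in>UNIV. snd z $ m * Y k (X m (Y l f)) z) = 2 * (\<Sum>m\<in>UNIV. snd z $ m * X m (g l k) z)"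
  proof -
    have "Y k (X m (Y l f)) z = 2 * X m (g l k) z" for m
      using z by (subst D_commute) (simp_all add: g_eq D_rules)
    then show ?thesis by (simp add: sum_distrib_left mult.left_commute)
  qed
  moreover have "Y k (X l f) z = X l (Y k f) z" using z by (simp add: D_commute)
  moreover have "(\<Sum>i\<in>UNIV. Y k (g l i) z * G i z) = (\<Sum>i\<in>UNIV. G i z * Y i (g l k) z)"
    using z by (simp add: mult.commute Yg_sym(2)[of z k])
  moreover have "s = 1/4 * (A - B) + 1/2 * P - t'"
    if "s + t = r / 4" "r = A + M - B'" "M = 2 * P" "B' = B" "t = t'" for s t t' r A B B' M P :: real
    using that by (simp add: field_simps)
  ultimately show ?thesis by blast
qed

section \<open>Coefficients of the Chern connection\<close>

definition \<delta> where "\<delta> k a w = X k a w - (\<Sum>m\<in>UNIV. N m k w * Y m a w)"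

text \<open>Christoffel symbols of the first kind, with horizontal derivatives in place of the
  partial ones.\<close>

definition \<gamma> where "\<gamma> l j k w = (\<delta> k (g j l) w + \<delta> j (g l k) w - \<delta> l (g j k) w) / 2"

definition \<Gamma> where "\<Gamma> i j k w = (\<Sum>l\<in>UNIV. h i l w * \<gamma> l j k w)"

lemma smooth_\<Gamma> [simp]: "smooth (\<Gamma> i j k)"
  by (simp add: \<Gamma>_def[abs_def] \<gamma>_def[abs_def] \<delta>_def)

lemma \<delta>_g_sym: "z \<in> S \<Longrightarrow> \<delta> k (g i j) z = \<delta> k (g j i) z"
  by (simp add: \<delta>_def Yg_sym(1)[of z _ i j])

lemma lower_\<Gamma>: "z \<in> S \<Longrightarrow> (\<Sum>i\<in>UNIV. g l i z * \<Gamma> i j k z) = \<gamma> l j k z"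
  by (simp add: \<Gamma>_def lower_raise)

lemma \<Gamma>_sym: "z \<in> S \<Longrightarrow> \<Gamma> i j k z = \<Gamma> i k j z"
  by (simp add: \<Gamma>_def \<gamma>_def \<delta>_g_sym[of z _ j k] \<delta>_g_sym[of z k] \<delta>_g_sym[of z j] add.commute)

lemma \<delta>_g:
  assumes "z \<in> S"
  shows "\<delta> k (g i j) z = (\<Sum>m\<in>UNIV. g m j z * \<Gamma> m i k z) + (\<Sum>m\<in>UNIV. g i m z * \<Gamma> m j k z)"
proof -
  have "(\<Sum>m\<in>UNIV. g m j z * \<Gamma> m i k z) = \<gamma> j i k z"
    using lower_\<Gamma>[OF assms] by (simp add: g_sym[OF assms, of _ j])
  then show ?thesis
    using lower_\<Gamma>[OF assms, of i j k] \<delta>_g_sym[OF assms, of k i j] \<delta>_g_sym[OF assms, of i j k]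
      \<delta>_g_sym[OF assms, of j i k] by (simp add: \<gamma>_def)
qed

text \<open>Where y meets an index of g, Euler's relations give derivatives of f and the terms with
  N drop; where y meets the derivative index, N contracts to 2 G. The sum is the right side of
  \<open>lower_N\<close>.\<close>

lemma \<gamma>_radial:
  assumes z: "z \<in> S"
  shows "(\<Sum>j\<in>UNIV. snd z $ j * \<gamma> l j k z) = (\<Sum>i\<in>UNIV. g l i z * N i k z)"
proof -
  have a: "(\<Sum>j\<in>UNIV. snd z $ j * \<delta> k (g j l) z) = X k (Y l f) z / 2" for k l
  proof -
    have "X k (\<lambda>w. \<Sum>j\<in>UNIV. snd w $ j * g l j w) z = X k (\<lambda>w. Y l f w / 2) z"
      by (rule D_cong[OF g_radial z])
    then have "(\<Sum>j\<in>UNIV. snd z $ j * X k (g j l) z) = X k (Y l f) z / 2"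
      using z by (simp add: D_rules D_sum Yg_sym(1)[OF z, of _ l])
    moreover have "(\<Sum>j\<in>UNIV. snd z $ j * (\<Sum>m\<in>UNIV. N m k z * Y m (g j l) z))
        = (\<Sum>m\<in>UNIV. N m k z * (\<Sum>j\<in>UNIV. snd z $ j * Y m (g j l) z))"
      by (simp add: sum_distrib_left mult.left_commute) (rule sum.swap)
    ultimately show ?thesis
      using Yg_radial[OF z] by (simp add: \<delta>_def algebra_simps sum_subtractf)
  qed
  have "(\<Sum>j\<in>UNIV. snd z $ j * (\<Sum>m\<in>UNIV. N m j z * Y m (g l k) z))
      = (\<Sum>m\<in>UNIV. (\<Sum>j\<in>UNIV. snd z $ j * N m j z) * Y m (g l k) z)"
    by (simp add: sum_distrib_left sum_distrib_right mult.assoc) (rule sum.swap)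
  then have b: "(\<Sum>j\<in>UNIV. snd z $ j * \<delta> j (g l k) z)
      = (\<Sum>j\<in>UNIV. snd z $ j * X j (g l k) z) - 2 * (\<Sum>m\<in>UNIV. G m z * Y m (g l k) z)"
    by (simp add: \<delta>_def right_diff_distrib sum_subtractf N_radial[OF z] mult.assoc sum_distrib_left)
  have "(\<Sum>j\<in>UNIV. snd z $ j * \<gamma> l j k z) = ((\<Sum>j\<in>UNIV. snd z $ j * \<delta> k (g j l) z)
      + (\<Sum>j\<in>UNIV. snd z $ j * \<delta> j (g l k) z) - (\<Sum>j\<in>UNIV. snd z $ j * \<delta> l (g j k) z)) / 2"
    by (simp add: \<gamma>_def sum_divide_distrib sum.distrib[symmetric] sum_subtractf[symmetric] algebra_simps)
  then show ?thesis unfolding a b lower_N[OF z] by (simp add: field_simps)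
qed

lemma \<Gamma>_radial:
  assumes z: "z \<in> S"
  shows "(\<Sum>j\<in>UNIV. snd z $ j * \<Gamma> i j k z) = N i k z"
proof -
  have "(\<Sum>j\<in>UNIV. snd z $ j * \<Gamma> i j k z) = (\<Sum>l\<in>UNIV. h i l z * (\<Sum>j\<in>UNIV. snd z $ j * \<gamma> l j k z))"
    by (simp add: \<Gamma>_def sum_distrib_left mult.left_commute) (rule sum.swap)
  then show ?thesis by (simp add: \<gamma>_radial[OF z] raise_lower[OF z])
qed

section \<open>The Chern forms and the curvature P\<close>

lemma f_pos: assumes "z \<in> S" shows "f z > 0"
proof -
  have "2 * f z = (\<Sum>i\<in>UNIV. snd z $ i * Y i f z)" using homog_euler[OF homog_f assms] by simp
  also have "\<dots> = 2 * (\<Sum>i\<in>UNIV. snd z $ i * (\<Sum>j\<in>UNIV. snd z $ j * g i j z))"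
    by (simp add: g_radial[OF assms] sum_distrib_left)
  also have "\<dots> = 2 * (snd z \<bullet> (fundamental_tensor F z *v snd z))"
    by (simp add: inner_vec_def matrix_vector_mult_def g_def mult.commute)
  finally show ?thesis using pos_F[of z "snd z"] assms by (cases z) (simp add: S_def)
qed

lemma F_nz: "z \<in> S \<Longrightarrow> F z \<noteq> 0"
  using f_pos[of z] by (auto simp: f_def)

definition \<omega> :: "(real ^ 'n) \<times> (real ^ 'n) \<Rightarrow> 'n \<Rightarrow> 'n \<Rightarrow> (real ^ 'n) \<times> (real ^ 'n) \<Rightarrow> real" where
  "\<omega> z j i u = (\<Sum>k\<in>UNIV. \<Gamma> i j k z * fst u $ k)"

text \<open>The Cartan term is the vertical part of dg: \<open>2 * cartan_tensor F i j k z\<close>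
  is F times \<open>Y k (g i j) z\<close>, and this F cancels the 1 / F in
  \<open>delta_y_form\<close>.\<close>

lemma structure_dg:
  assumes z: "z \<in> S"
  shows "dir_deriv u (g i j) z - (\<Sum>k\<in>UNIV. 2 * cartan_tensor F i j k z * delta_y_form F k z u)
    = (\<Sum>k\<in>UNIV. fst u $ k * \<delta> k (g i j) z)"
proof -
  have A: "2 * cartan_tensor F i j k z * delta_y_form F k z u
      = (snd u $ k + (\<Sum>m\<in>UNIV. N k m z * fst u $ m)) * Y k (g i j) z" for k
    using z F_nz[OF z]
    by (simp add: cartan_tensor_def delta_y_form_def pdy_dir_deriv f_eq g_eq D_rules N_eq)
  have "(\<Sum>k\<in>UNIV. fst u $ k * (\<Sum>m\<in>UNIV. N m k z * Y m (g i j) z))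
      = (\<Sum>k\<in>UNIV. (\<Sum>m\<in>UNIV. N k m z * fst u $ m) * Y k (g i j) z)"
    by (simp add: sum_distrib_left sum_distrib_right mult_ac) (rule sum.swap)
  then show ?thesis
    unfolding A using dir_deriv_expand[OF smooth_differentiable[OF smooth_g z], of u i j]
    by (simp add: \<delta>_def right_diff_distrib distrib_right sum.distrib sum_subtractf)
qed

lemma chern_structure_eqs_\<omega>:
  assumes z: "z \<in> S"
  shows "chern_structure_eqs F z (\<omega> z)"
  unfolding chern_structure_eqs_def
proof (intro conjI allI)
  show "linear (\<omega> z j i)" for j i
    by (rule linearI) (simp_all add: \<omega>_def distrib_left sum.distrib sum_distrib_left mult.left_commute)
  show "(\<Sum>j\<in>UNIV. wedge (dx_form j) (\<omega> z j i) u v) = 0" for i u v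
  proof -
    have "(\<Sum>j\<in>UNIV. fst u $ j * \<omega> z j i v) = (\<Sum>j\<in>UNIV. fst v $ j * \<omega> z j i u)"
      unfolding \<omega>_def sum_distrib_left
      by (subst sum.swap) (simp add: mult_ac \<Gamma>_sym[OF z, of i])
    then show ?thesis by (simp add: wedge_def dx_form_def sum_subtractf)
  qed
  fix i j u
  have "(\<Sum>k\<in>UNIV. fst u $ k * \<delta> k (g i j) z)
      = (\<Sum>k\<in>UNIV. g k j z * \<omega> z i k u) + (\<Sum>k\<in>UNIV. g i k z * \<omega> z j k u)"
  proof -
    have "(\<Sum>k\<in>UNIV. fst u $ k * (\<Sum>m\<in>UNIV. t m * \<Gamma> m l k z)) = (\<Sum>k\<in>UNIV. t k * \<omega> z l k u)" for t l
      unfolding \<omega>_def sum_distrib_left by (subst sum.swap) (simp add: mult_ac)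
    then show ?thesis by (simp add: \<delta>_g[OF z] distrib_left sum.distrib)
  qed
  then show "frechet_derivative (\<lambda>w. fundamental_tensor F w $ i $ j) (at z) u -
       (\<Sum>k\<in>UNIV. fundamental_tensor F z $ k $ j * \<omega> z i k u) -
       (\<Sum>k\<in>UNIV. fundamental_tensor F z $ i $ k * \<omega> z j k u) =
       (\<Sum>k\<in>UNIV. 2 * cartan_tensor F i j k z * delta_y_form F k z u)"
    using structure_dg[OF z, of u i j] by (simp add: g_def[abs_def] dir_deriv_def)
qed

text \<open>Needed since \<open>chern_form\<close> is a definite description. By the torsion
  condition the difference D of two solutions vanishes on vertical vectors and is symmetric on
  horizontal ones; lowered, it is skew by the metric condition.\<close>

lemma chern_structure_eqs_unique:
  assumes z: "z \<in> S" and \<omega>': "chern_structure_eqs F z \<omega>'"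
  shows "\<omega>' = \<omega> z"
proof -
  have lin': "linear (w j i)"
    and wedge': "(\<Sum>j\<in>UNIV. wedge (dx_form j) (w j i) u v) = 0"
    and metric': "frechet_derivative (\<lambda>w. fundamental_tensor F w $ i $ j) (at z) u
          - (\<Sum>k\<in>UNIV. g k j z * w i k u) - (\<Sum>k\<in>UNIV. g i k z * w j k u)
        = (\<Sum>k\<in>UNIV. 2 * cartan_tensor F i j k z * delta_y_form F k z u)"
    if "chern_structure_eqs F z w" for w i j u v
    using that unfolding chern_structure_eqs_def g_def by blast+
  note \<omega> = chern_structure_eqs_\<omega>[OF z]
  define D where "D j i u = \<omega>' j i u - \<omega> z j i u" for j i u
  have lin: "linear (D j i)" for j i
    unfolding D_def[abs_def] by (intro linear_compose_sub lin' \<omega>' \<omega>)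
  have wedge: "(\<Sum>j\<in>UNIV. fst u $ j * D j i v) = (\<Sum>j\<in>UNIV. fst v $ j * D j i u)" for i u v
    using wedge'[OF \<omega>', of i u v] wedge'[OF \<omega>, of i u v]
    by (simp add: wedge_def dx_form_def D_def sum_subtractf right_diff_distrib)
  have metric: "(\<Sum>k\<in>UNIV. g j k z * D i k u) + (\<Sum>k\<in>UNIV. g i k z * D j k u) = 0" for i j u
    using metric'[OF \<omega>', of i j u] metric'[OF \<omega>, of i j u]
    by (simp add: D_def right_diff_distrib sum_subtractf g_sym[OF z, of _ j])
  have vert: "D j i (0, b) = 0" for j i b
    using wedge[of "(axis j 1, 0)" i "(0, b)"] by simp
  have sym: "D j i (axis k 1, 0) = D k i (axis j 1, 0)" for i j k
    using wedge[of "(axis j 1, 0)" i "(axis k 1, 0)"] by simp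
  define T where "T i j k = (\<Sum>m\<in>UNIV. g i m z * D j m (axis k 1, 0))" for i j k
  have "T i j k = 0" for i j k
  proof (rule symmetric_skew_eq_0[of T])
    show "T a b c = T a c b" for a b c by (simp add: T_def sym[of b])
    show "T a b c = - T b a c" for a b c
      using metric[of a b "(axis c 1, 0)"] by (simp add: T_def)
  qed
  then have hor: "D j i (axis k 1, 0) = 0" for i j k
    using lower_cancel[OF z, of "\<lambda>i. D j i (axis k 1, 0)" "\<lambda>i. 0" i] by (simp add: T_def)
  have "D j i u = 0" for j i u
  proof -
    interpret linear "D j i" by (rule lin)
    show ?thesis
      by (subst pair_expand_axis[of u]) (simp add: add sum scale hor vert del: scaleR_Pair)
  qed
  then show ?thesis by (simp add: D_def fun_eq_iff)
qed

lemma chern_form_eq: "z \<in> S \<Longrightarrow> chern_form F j i z u = (\<Sum>k\<in>UNIV. \<Gamma> i j k z * fst u $ k)"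
  unfolding chern_form_def
  using the_equality[of "chern_structure_eqs F z" "\<omega> z"] chern_structure_eqs_\<omega> chern_structure_eqs_unique
  by (simp add: \<omega>_def)

text \<open>The connection forms are horizontal. On a horizontal and a vertical vector their wedge
  products vanish, and of the exterior derivative only the derivative along \<open>ver_vec\<close>,
  which carries the factor F, survives with a minus sign.\<close>

lemma chern_P_eq:
  assumes z: "z \<in> S"
  shows "chern_P F j i k l z = - F z * Y l (\<Gamma> i j k) z"
proof -
  have "dir_deriv v (\<lambda>w. chern_form F j i w (ver_vec F l z)) z = dir_deriv v (\<lambda>w. 0) z" for v
    by (rule D_cong[OF _ z]) (simp add: chern_form_eq ver_vec_def)
  moreover have "dir_deriv v (\<lambda>w. chern_form F j i w (hor_vec F k z)) z = dir_deriv v (\<Gamma> i j k) z" for v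
    by (rule D_cong[OF _ z]) (simp add: chern_form_eq hor_vec_def)
  moreover have "dir_deriv (ver_vec F l z) (\<Gamma> i j k) z = F z * Y l (\<Gamma> i j k) z"
    using D_vertical[OF smooth_\<Gamma> z, of "F z *\<^sub>R axis l 1" i j k] by (simp add: ver_vec_def mult.assoc sum_distrib_left[symmetric])
  ultimately show ?thesis
    using z by (simp add: chern_P_def chern_curvature_def ext_deriv_def wedge_def chern_form_eq ver_vec_def
        dir_deriv_def)
qed

lemma landsberg_imp_radial:
  assumes z: "z \<in> S" and L: "\<And>u v. landsberg_curvature F z u v = 0"
  shows "(\<Sum>j\<in>UNIV. snd z $ j * Y l (\<Gamma> i j k) z) = 0"
proof -
  define c where "c i = (\<Sum>j\<in>UNIV. (snd z $ j / F z) * chern_P F j i k l z)" for i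
  have w: "wedge (dx_form a) (delta_y_form F b z) (hor_vec F k z) (ver_vec F l z)
      = (if a = k then 1 else 0) * (if b = l then 1 else 0)" for a b
    using F_nz[OF z] by (simp add: wedge_def dx_form_hor_vec dx_form_ver_vec delta_y_form_ver_vec)
  have "(\<Sum>a\<in>UNIV. \<Sum>b\<in>UNIV. ((snd z $ j / F z) * chern_P F j i a b z *
        ((if a = k then 1 else 0) * (if b = l then 1 else 0))) *\<^sub>R hor_vec F i z)
      = ((snd z $ j / F z) * chern_P F j i k l z) *\<^sub>R hor_vec F i z" for i j
  proof -
    have *: "((snd z $ j / F z) * chern_P F j i a b z *
        ((if a = k then 1 else 0) * (if b = l then 1 else 0))) *\<^sub>R hor_vec F i z
      = (if b = l then if a = k then ((snd z $ j / F z) * chern_P F j i k l z) *\<^sub>R hor_vec F i z else 0 else 0)" for a b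
      by simp
    show ?thesis unfolding * by simp
  qed
  then have "(\<Sum>i\<in>UNIV. c i *\<^sub>R hor_vec F i z) = 0"
    using L[of "hor_vec F k z" "ver_vec F l z"]
    unfolding landsberg_curvature_def w by (simp only: c_def scaleR_sum_left)
  \<comment> \<open>The first halves of the vectors \<open>hor_vec\<close> are the coordinate axes,
    so the coefficients separate.\<close>
  then have "fst (\<Sum>i\<in>UNIV. c i *\<^sub>R hor_vec F i z) $ i = 0" by simp
  moreover have "axis x (1::real) $ i = axis i 1 $ x" for x :: 'n by (simp add: axis_def)
  ultimately have "c i = 0" by (simp add: fst_sum hor_vec_def)
  moreover have "c i = - (\<Sum>j\<in>UNIV. snd z $ j * Y l (\<Gamma> i j k) z)"
    using F_nz[OF z] by (simp add: c_def chern_P_eq[OF z] sum_negf[symmetric])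
  ultimately show ?thesis by simp
qed

end

section \<open>The Berwald curvature of a Landsberg metric\<close>

locale landsberg_chart = finsler_chart +
  assumes landsberg: "\<And>z u v. z \<in> U \<times> - {0} \<Longrightarrow> landsberg_curvature F z u v = 0"
begin

text \<open>In the Landsberg case the Chern and Berwald connections coincide.\<close>

lemma Y_N:
  assumes z: "z \<in> S"
  shows "Y l (N i k) z = \<Gamma> i l k z"
proof -
  have "Y l (\<lambda>w. \<Sum>j\<in>UNIV. snd w $ j * \<Gamma> i j k w) z = Y l (N i k) z"
    by (rule D_cong[OF \<Gamma>_radial z])
  then show ?thesis
    using z landsberg_imp_radial[OF z landsberg[OF z[unfolded S_def]]]
    by (simp add: D_rules D_sum sum.distrib)
qed

text \<open>The Berwald curvature with its upper index lowered into the slot i. By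
  \<open>Y_\<Gamma>\<close> the indices j, k, l are commuting fibre derivatives of the spray, so
  only exchanges with i need an argument.\<close>

definition B where "B i j k l w = (\<Sum>m\<in>UNIV. g i m w * Y l (\<Gamma> m j k) w)"

lemma Y_\<Gamma>:
  assumes z: "z \<in> S"
  shows "Y l (\<Gamma> i j k) z = Y l (Y j (Y k (G i))) z"
  using D_cong[OF Y_N[symmetric, of _ i j k] z, where v = "(0, axis l 1)"] by (simp add: N_def)

lemma B_sym:
  assumes z: "z \<in> S"
  shows "B i j k l z = B i l k j z"
proof -
  have "Y l (\<Gamma> m j k) z = Y j (\<Gamma> m l k) z" for m
    unfolding Y_\<Gamma>[OF z] by (rule D_commute) (use z in auto)
  then show ?thesis by (simp add: B_def)
qed

text \<open>The fibre derivative of \<open>\<delta>_g\<close>, with the derivatives of \<Gamma>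
  collected on the left. The point is that the right side is symmetric in i, j and l.\<close>

lemma B_add_swap:
  assumes z: "z \<in> S"
  shows "B i j k l z + B j i k l z = X k (Y l (g i j)) z - (\<Sum>m\<in>UNIV. N m k z * Y m (Y l (g i j)) z)
    - (\<Sum>m\<in>UNIV. \<Gamma> m l k z * Y m (g i j) z) - (\<Sum>m\<in>UNIV. \<Gamma> m i k z * Y m (g j l) z)
    - (\<Sum>m\<in>UNIV. \<Gamma> m j k z * Y m (g i l) z)"
proof -
  have "Y l (\<delta> k (g i j)) z = Y l (\<lambda>w. (\<Sum>m\<in>UNIV. g m j w * \<Gamma> m i k w) + (\<Sum>m\<in>UNIV. g i m w * \<Gamma> m j k w)) z"
    by (rule D_cong[OF \<delta>_g z])
  moreover have "Y l (\<delta> k (g i j)) z = X k (Y l (g i j)) z - (\<Sum>m\<in>UNIV. N m k z * Y m (Y l (g i j)) z)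
      - (\<Sum>m\<in>UNIV. \<Gamma> m l k z * Y m (g i j) z)"
    using z by (simp add: \<delta>_def[abs_def] D_rules D_sum sum.distrib Y_N
        D_commute[of "g i j" z "(0, axis l 1)"])
  moreover have "Y l (\<lambda>w. (\<Sum>m\<in>UNIV. g m j w * \<Gamma> m i k w) + (\<Sum>m\<in>UNIV. g i m w * \<Gamma> m j k w)) z
      = (B j i k l z + (\<Sum>m\<in>UNIV. \<Gamma> m i k z * Y m (g j l) z))
        + (B i j k l z + (\<Sum>m\<in>UNIV. \<Gamma> m j k z * Y m (g i l) z))"
  proof -
    have "Y l (g m j) z = Y m (g j l) z" "Y l (g i m) z = Y m (g i l) z" for m
      using Yg_sym[OF z] by metis+
    then show ?thesis
      using z by (simp add: D_rules D_sum sum.distrib B_def g_sym[OF z, of _ j] mult.commute)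
  qed
  ultimately show ?thesis by linarith
qed

text \<open>Exchanging j and l leaves the right side of \<open>B_add_swap\<close> alone; by
  \<open>B_sym\<close> the first summands cancel, and the lowered slot trades places with a
  derivative slot.\<close>

lemma B_sym_first:
  assumes z: "z \<in> S"
  shows "B j i k l z = B l i k j z"
proof -
  have Dsym: "dir_deriv v (Y l (g i j)) z = dir_deriv v (Y j (g i l)) z" for v
    by (rule D_cong[OF Yg_sym(2) z])
  have "B i j k l z + B j i k l z = B i l k j z + B l i k j z"
    unfolding B_add_swap[OF z] Dsym Yg_sym(1)[OF z, of _ l j] by linarith
  with B_sym[OF z, of i j k l] show ?thesis by simp
qed

lemma trace_B:
  assumes z: "z \<in> S" and E: "\<And>j k. mean_berwald F j k z = 0"
  shows "(\<Sum>a\<in>UNIV. \<Sum>b\<in>UNIV. h a b z * Y a (Y b (N i k)) z) = 0"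
proof (rule lower_cancel[OF z, of "\<lambda>i. \<Sum>a\<in>UNIV. \<Sum>b\<in>UNIV. h a b z * Y a (Y b (N i k)) z" "\<lambda>i. 0", simplified])
  fix j
  have YN: "Y a (Y b (N i k)) z = Y a (\<Gamma> i b k) z" for a b i
    by (rule D_cong[OF Y_N z])
  have "(\<Sum>i\<in>UNIV. g j i z * (\<Sum>a\<in>UNIV. \<Sum>b\<in>UNIV. h a b z * Y a (Y b (N i k)) z))
     = (\<Sum>a\<in>UNIV. \<Sum>b\<in>UNIV. h a b z * B j b k a z)"
    unfolding YN B_def sum_distrib_left
    by (subst sum.swap, rule sum.cong[OF refl], subst sum.swap) (simp add: mult_ac)
  \<comment> \<open>The free index j moves from the lowered slot to the derivative slot, so that h
    raises the lowered index again and produces the trace of \<Gamma>.\<close>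
  also have "\<dots> = (\<Sum>b\<in>UNIV. \<Sum>a\<in>UNIV. h b a z * B a b k j z)"
    by (subst sum.swap) (simp add: h_sym[OF z] B_sym_first[OF z, of j])
  also have "\<dots> = (\<Sum>b\<in>UNIV. Y j (\<Gamma> b b k) z)"
    by (simp add: B_def raise_lower[OF z])
  also have "\<dots> = Y j (Y k (\<lambda>w. \<Sum>m\<in>UNIV. Y m (G m) w)) z"
  proof -
    have "Y j (Y k (\<lambda>w. \<Sum>m\<in>UNIV. Y m (G m) w)) z = Y j (\<lambda>w. \<Sum>m\<in>UNIV. Y k (Y m (G m)) w) z"
      by (rule D_cong[OF D_sum z]) auto
    moreover have "Y j (Y k (Y b (G b))) z = Y j (Y b (Y k (G b))) z" for b
      by (rule D_cong[OF D_commute z]) auto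
    ultimately show ?thesis
      using z by (simp add: D_sum Y_\<Gamma>)
  qed
  also have "\<dots> = 0"
    using E[of j k] by (simp add: mean_berwald_def pdy_dir_deriv G_def)
  finally show "(\<Sum>i\<in>UNIV. g j i z * (\<Sum>a\<in>UNIV. \<Sum>b\<in>UNIV. h a b z * Y a (Y b (N i k)) z)) = 0" .
qed

end

section \<open>Hilbert's linearity theorem\<close>

context finsler_chart
begin

text \<open>h = h g h: the form h at v is the form g at the raised vector t.\<close>

lemma quad_h_nonneg:
  assumes z: "z \<in> S"
  shows "quad (\<lambda>i j. h i j z) v \<ge> 0"
proof -
  define t where "t i = (\<Sum>j\<in>UNIV. h i j z * v j)" for i
  have v: "v i = (\<Sum>m\<in>UNIV. g i m z * t m)" for i
    unfolding t_def lower_raise[OF z] ..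
  have "quad (\<lambda>i j. h i j z) v = (\<Sum>i\<in>UNIV. t i * v i)"
    by (simp add: quad_def t_def sum_distrib_left sum_distrib_right mult_ac)
  also have "\<dots> = (\<chi> i. t i) \<bullet> (fundamental_tensor F z *v (\<chi> i. t i))"
    by (simp add: inner_vec_def matrix_vector_mult_def g_def[symmetric] v)
  also have "\<dots> \<ge> 0"
    using pos_F[of z "\<chi> i. t i"] z by (cases "(\<chi> i. t i) = 0") (auto simp: S_def)
  finally show ?thesis .
qed

definition d where "d w = det (fundamental_tensor F w)"

lemma d_pos: "z \<in> S \<Longrightarrow> d z > 0"
  unfolding d_def S_def by (intro det_pos_of_positive_definite pos_F)

lemma smooth_d [simp]: "smooth d"
  unfolding d_def[abs_def] by (rule smooth_on_det[OF open_S]) (simp add: g_def[symmetric])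

lemma D_d:
  assumes z: "z \<in> S"
  shows "dir_deriv v d z = d z * (\<Sum>i\<in>UNIV. \<Sum>j\<in>UNIV. dir_deriv v (g i j) z * h j i z)"
proof -
  have "((\<lambda>w. fundamental_tensor F w $ i $ j) has_derivative (\<lambda>v. dir_deriv v (g i j) z)) (at z)" for i j
    using dir_deriv_has_derivative[OF smooth_differentiable[OF smooth_g z], of i j] by (simp add: g_def[abs_def])
  from dir_derivI[OF has_derivative_det[OF this matrix_inv_mult(2)[OF fundamental_tensor_invertible[OF z]]], of v]
  show ?thesis by (simp add: d_def[abs_def] h_def)
qed

text \<open>The cofactor matrix of a Hessian is divergence free.\<close>

lemma div_d_h:
  assumes z: "z \<in> S"
  shows "(\<Sum>i\<in>UNIV. Y i (\<lambda>w. d w * h i j w) z) = 0"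
proof -
  have "(\<Sum>i\<in>UNIV. Y i d z * h i j z) = d z * (\<Sum>i\<in>UNIV. (\<Sum>p\<in>UNIV. \<Sum>q\<in>UNIV. Y i (g p q) z * h q p z) * h i j z)"
    unfolding D_d[OF z] by (simp only: sum_distrib_left[symmetric] mult.assoc)
  also have "(\<Sum>i\<in>UNIV. (\<Sum>p\<in>UNIV. \<Sum>q\<in>UNIV. Y i (g p q) z * h q p z) * h i j z)
      = (\<Sum>i\<in>UNIV. \<Sum>p\<in>UNIV. \<Sum>q\<in>UNIV. h p q z * (Y p (g q i) z * h i j z))"
  proof -
    \<comment> \<open>Total symmetry turns the term from Jacobi's formula into the one from
      differentiating h, which has the opposite sign.\<close>
    have "Y i (g p q) z * h q p z * h i j z = h p q z * (Y p (g q i) z * h i j z)" for i p q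
      using Yg_sym(1)[OF z, of "(0, axis i 1)" p q] Yg_sym(2)[OF z, of i q p] h_sym[OF z, of q p] by simp
    then show ?thesis by (simp only: sum_distrib_right)
  qed
  also have "\<dots> = (\<Sum>p\<in>UNIV. \<Sum>q\<in>UNIV. \<Sum>i\<in>UNIV. h p q z * (Y p (g q i) z * h i j z))"
    by (rule sum_rotate[symmetric])
  also have "\<dots> = - (\<Sum>i\<in>UNIV. Y i (h i j) z)"
    unfolding D_h[OF z] by (simp add: sum_distrib_left sum_negf)
  finally show ?thesis using z by (simp add: D_rules sum.distrib sum_distrib_left[symmetric])
qed

end

text \<open>The trace is the derivative of log det(g) when Hess u is added to g, so u is a direction
  in which det(g) is stationary. It will be a component \<open>N i k\<close>, for which
  \<open>trace_B\<close> supplies the equation.\<close>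

locale linearised_chart = finsler_chart U F
  for U :: "(real ^ 'n::finite) set" and F +
  fixes u :: "(real ^ 'n) \<times> (real ^ 'n) \<Rightarrow> real"
  assumes homog_u: "homog 1 u"
    and trace_u: "\<And>z. z \<in> S \<Longrightarrow> (\<Sum>a\<in>UNIV. \<Sum>b\<in>UNIV. h a b z * Y a (Y b u) z) = 0"
begin

lemma smooth_u [simp]: "smooth u"
  using homog_u by (simp add: homog_def)

text \<open>\<open>V\<close> is Hess u with both indices raised. Raising them in two stages lets the
  product rule for d V split off the divergence-free factor d h and leave derivatives of
  \<open>M\<close>.\<close>

definition M where "M k j w = (\<Sum>l\<in>UNIV. Y k (Y l u) w * h l j w)"
definition V where "V i j w = (\<Sum>k\<in>UNIV. h i k w * M k j w)"

lemma smooth_M [simp]: "smooth (M k j)"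
  by (simp add: M_def[abs_def])

lemma smooth_V [simp]: "smooth (V k j)"
  by (simp add: V_def[abs_def])

lemma hess_radial: "z \<in> S \<Longrightarrow> (\<Sum>a\<in>UNIV. snd z $ a * Y a (Y b u) z) = 0"
  using homog_euler[OF homog_Y[OF homog_u], of z b] by simp

lemma V_eq: "z \<in> S \<Longrightarrow> V i j z = (\<Sum>k\<in>UNIV. \<Sum>l\<in>UNIV. h i k z * h j l z * Y k (Y l u) z)"
  by (simp add: V_def M_def sum_distrib_left mult_ac h_sym[of z j])

lemma V_contract: "(\<Sum>k\<in>UNIV. h i k z * (\<Sum>l\<in>UNIV. Y k (Y l u) z * (\<Sum>a\<in>UNIV. h l a z * t a)))
    = (\<Sum>a\<in>UNIV. V i a z * t a)"
  unfolding V_def M_def sum_distrib_left sum_distrib_right mult.assoc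
  by (rule sum_rotate)

text \<open>Differentiating the trace equation trades contracted third derivatives of u, over which
  there is no control, for V against derivatives of g.\<close>

lemma trace_deriv:
  assumes z: "z \<in> S"
  shows "(\<Sum>i\<in>UNIV. \<Sum>k\<in>UNIV. h i k z * Y l (Y i (Y k u)) z) = (\<Sum>a\<in>UNIV. \<Sum>b\<in>UNIV. V a b z * Y l (g a b) z)"
proof -
  have "Y l (\<lambda>w. \<Sum>i\<in>UNIV. \<Sum>k\<in>UNIV. h i k w * Y i (Y k u) w) z = Y l (\<lambda>w. 0) z"
    by (rule D_cong[OF trace_u z])
  then have "(\<Sum>i\<in>UNIV. \<Sum>k\<in>UNIV. h i k z * Y l (Y i (Y k u)) z)
      = - (\<Sum>i\<in>UNIV. \<Sum>k\<in>UNIV. Y l (h i k) z * Y i (Y k u) z)"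
    using z by (simp add: D_sum D_rules sum.distrib)
  also have "\<dots> = (\<Sum>i\<in>UNIV. \<Sum>k\<in>UNIV. \<Sum>a\<in>UNIV. \<Sum>b\<in>UNIV.
      h i a z * (Y l (g a b) z * h b k z) * Y i (Y k u) z)"
    unfolding D_h[OF z] by (simp add: sum_negf sum_distrib_left sum_distrib_right)
  also have "\<dots> = (\<Sum>a\<in>UNIV. \<Sum>b\<in>UNIV. \<Sum>i\<in>UNIV. \<Sum>k\<in>UNIV.
      h i a z * (Y l (g a b) z * h b k z) * Y i (Y k u) z)"
    by (rule sum_swap_pairs)
  also have "\<dots> = (\<Sum>a\<in>UNIV. \<Sum>b\<in>UNIV. V a b z * Y l (g a b) z)"
    by (simp add: V_eq[OF z] sum_distrib_left sum_distrib_right mult_ac h_sym[OF z, of _ a for a])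
  finally show ?thesis .
qed

text \<open>By \<open>div_d_h\<close> only h against the derivatives of \<open>M\<close> is left.
  There \<open>trace_deriv\<close> turns the third derivatives of u into V against derivatives of g,
  and differentiating h yields the same with a minus sign.\<close>

lemma div_d_V:
  assumes z: "z \<in> S"
  shows "(\<Sum>i\<in>UNIV. Y i (\<lambda>w. d w * V i j w) z) = 0"
proof -
  have "Y i (\<lambda>w. d w * V i j w) z
      = (\<Sum>k\<in>UNIV. d z * h i k z * Y i (M k j) z) + (\<Sum>k\<in>UNIV. Y i (\<lambda>w. d w * h i k w) z * M k j z)" for i
  proof -
    have "(\<lambda>w. d w * V i j w) = (\<lambda>w. \<Sum>k\<in>UNIV. (d w * h i k w) * M k j w)"
      by (simp add: V_def sum_distrib_left mult.assoc)
    moreover have "Y i (\<lambda>w. (d w * h i k w) * M k j w) z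
        = d z * h i k z * Y i (M k j) z + Y i (\<lambda>w. d w * h i k w) z * M k j z" for k
      using D_rules(3)[OF z, of "\<lambda>w. d w * h i k w" "M k j"] by simp
    ultimately show ?thesis using z by (simp add: D_sum sum.distrib)
  qed
  moreover have "(\<Sum>i\<in>UNIV. \<Sum>k\<in>UNIV. Y i (\<lambda>w. d w * h i k w) z * M k j z) = 0"
    by (subst sum.swap) (simp add: sum_distrib_right[symmetric] div_d_h[OF z])
  ultimately have eq: "(\<Sum>i\<in>UNIV. Y i (\<lambda>w. d w * V i j w) z)
      = d z * (\<Sum>i\<in>UNIV. \<Sum>k\<in>UNIV. h i k z * Y i (M k j) z)"
    by (simp add: sum.distrib sum_distrib_left mult.assoc)
  have "Y i (M k j) z = (\<Sum>l\<in>UNIV. Y l (Y i (Y k u)) z * h l j z)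
      - (\<Sum>l\<in>UNIV. Y k (Y l u) z * (\<Sum>a\<in>UNIV. h l a z * (\<Sum>b\<in>UNIV. Y i (g a b) z * h b j z)))" for i k
    using z by (simp add: M_def[abs_def] D_sum D_rules sum.distrib sum_subtractf D_h sum_negf D_commute3[of u z "(0, axis i 1)"])
  then have "(\<Sum>i\<in>UNIV. \<Sum>k\<in>UNIV. h i k z * Y i (M k j) z)
    = (\<Sum>i\<in>UNIV. \<Sum>k\<in>UNIV. \<Sum>l\<in>UNIV. h i k z * Y l (Y i (Y k u)) z * h l j z)
      - (\<Sum>i\<in>UNIV. \<Sum>a\<in>UNIV. V i a z * (\<Sum>b\<in>UNIV. Y i (g a b) z * h b j z))"
    unfolding V_contract[symmetric]
    by (simp add: right_diff_distrib sum_subtractf sum_distrib_left[of "h _ _ _"] mult.assoc)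
  moreover have "(\<Sum>i\<in>UNIV. \<Sum>k\<in>UNIV. \<Sum>l\<in>UNIV. h i k z * Y l (Y i (Y k u)) z * h l j z)
      = (\<Sum>l\<in>UNIV. (\<Sum>a\<in>UNIV. \<Sum>b\<in>UNIV. V a b z * Y l (g a b) z) * h l j z)"
    unfolding trace_deriv[OF z, symmetric] sum_distrib_right by (rule sum_rotate)
  moreover have "(\<Sum>i\<in>UNIV. \<Sum>a\<in>UNIV. V i a z * (\<Sum>b\<in>UNIV. Y i (g a b) z * h b j z))
      = (\<Sum>b\<in>UNIV. (\<Sum>i\<in>UNIV. \<Sum>a\<in>UNIV. V i a z * Y b (g i a) z) * h b j z)"
  proof -
    have "Y i (g a b) z = Y b (g i a) z" for a b i
      using Yg_sym(2)[OF z, of i a b] Yg_sym(1)[OF z, of "(0, axis b 1)" a i] by simp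
    then show ?thesis unfolding sum_distrib_right sum_distrib_left mult.assoc
      by (subst sum_rotate) simp
  qed
  ultimately show ?thesis using eq by simp
qed

definition flux where "flux i w = d w * (\<Sum>j\<in>UNIV. V i j w * Y j u w)"

lemma smooth_flux [simp]: "smooth (flux i)"
  by (simp add: flux_def[abs_def])

lemma div_flux:
  assumes z: "z \<in> S"
  shows "(\<Sum>i\<in>UNIV. Y i (flux i) z) = d z * (\<Sum>i\<in>UNIV. \<Sum>j\<in>UNIV. V i j z * Y i (Y j u) z)"
proof -
  have "Y i (flux i) z = (\<Sum>j\<in>UNIV. d z * V i j z * Y i (Y j u) z) + (\<Sum>j\<in>UNIV. Y i (\<lambda>w. d w * V i j w) z * Y j u z)" for i
  proof -
    have "flux i = (\<lambda>w. \<Sum>j\<in>UNIV. (d w * V i j w) * Y j u w)"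
      by (simp add: fun_eq_iff flux_def sum_distrib_left mult.assoc)
    moreover have "Y i (\<lambda>w. (d w * V i j w) * Y j u w) z
        = d z * V i j z * Y i (Y j u) z + Y i (\<lambda>w. d w * V i j w) z * Y j u z" for j
      using D_rules(3)[OF z, of "\<lambda>w. d w * V i j w" "Y j u"] by simp
    ultimately show ?thesis using z by (simp add: D_sum sum.distrib)
  qed
  moreover have "(\<Sum>i\<in>UNIV. \<Sum>j\<in>UNIV. Y i (\<lambda>w. d w * V i j w) z * Y j u z) = 0"
    by (subst sum.swap) (simp add: sum_distrib_right[symmetric] div_d_V[OF z])
  ultimately show ?thesis by (simp add: sum.distrib sum_distrib_left mult.assoc)
qed

text \<open>As df = 2 g y, one factor h of V is undone and y meets Hess u, which it annihilates
  since grad u has degree 0. The flux is tangent to the level sets of f.\<close>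

lemma flux_tangential:
  assumes z: "z \<in> S"
  shows "(\<Sum>i\<in>UNIV. Y i f z * flux i z) = 0"
proof -
  have "(\<Sum>i\<in>UNIV. Y i f z * V i j z) = 0" for j
  proof -
    have "Y i f z = 2 * (\<Sum>a\<in>UNIV. snd z $ a * g i a z)" for i using g_radial[OF z, of i] by simp
    then have "(\<Sum>i\<in>UNIV. Y i f z * V i j z) = 2 * (\<Sum>i\<in>UNIV. \<Sum>a\<in>UNIV. snd z $ a * (g a i z * V i j z))"
      by (simp add: sum_distrib_left sum_distrib_right mult_ac g_sym[OF z, of _ a for a])
    also have "\<dots> = 2 * (\<Sum>a\<in>UNIV. snd z $ a * (\<Sum>i\<in>UNIV. g a i z * V i j z))"
      by (subst sum.swap) (simp add: sum_distrib_left)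
    also have "\<dots> = 2 * (\<Sum>a\<in>UNIV. snd z $ a * M a j z)"
      unfolding V_def lower_raise[OF z] ..
    also have "\<dots> = 2 * (\<Sum>l\<in>UNIV. (\<Sum>a\<in>UNIV. snd z $ a * Y a (Y l u) z) * h l j z)"
      unfolding M_def sum_distrib_left sum_distrib_right by (subst sum.swap) (simp add: mult.assoc)
    finally show ?thesis by (simp add: hess_radial[OF z])
  qed
  moreover have "(\<Sum>i\<in>UNIV. Y i f z * flux i z) = (\<Sum>j\<in>UNIV. d z * (\<Sum>i\<in>UNIV. Y i f z * V i j z) * Y j u z)"
    unfolding flux_def sum_distrib_left sum_distrib_right by (subst sum.swap) (simp add: mult_ac)
  ultimately show ?thesis by simp
qed

end

section \<open>Cutoff and integration over a fibre\<close>

context finsler_chart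
begin

text \<open>Compactness of the unit sphere and homogeneity compare f with the Euclidean norm, so the
  region \<alpha> < f < \<beta> of a fibre lies between two spheres when \<alpha> is
  positive.\<close>

lemma f_bounds:
  assumes x: "x \<in> U"
  obtains m K where "0 < m" "0 < K" "\<And>y. m * (norm y)\<^sup>2 \<le> f (x, y)" "\<And>y. f (x, y) \<le> K * (norm y)\<^sup>2"
proof -
  let ?S = "sphere 0 1 :: (real ^ 'n) set"
  have "continuous_on ?S (\<lambda>y. f (x, y))"
    by (rule continuous_on_compose2[OF smooth_on_continuous_on[OF smooth_f]])
      (use x in \<open>auto intro!: continuous_intros simp: S_def\<close>)
  moreover have "?S \<noteq> {}" by (metis axis_eq_axis norm_axis_1 mem_sphere_0 empty_iff)
  ultimately obtain a b where ab: "a \<in> ?S" "b \<in> ?S"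
    and le: "\<And>y. y \<in> ?S \<Longrightarrow> f (x, a) \<le> f (x, y) \<and> f (x, y) \<le> f (x, b)"
    using continuous_attains_inf[of ?S "\<lambda>y. f (x, y)"] continuous_attains_sup[of ?S "\<lambda>y. f (x, y)"]
    by (metis compact_sphere)
  have pos: "f (x, y) > 0" if "y \<in> ?S" for y
    using that x by (intro f_pos) (auto simp: S_def)
  have zero: "f (x, 0) = 0" using f_scale[OF x, of 2 0] by simp
  have scale: "f (x, y) = (norm y)\<^sup>2 * f (x, (1 / norm y) *\<^sub>R y)" "(1 / norm y) *\<^sub>R y \<in> ?S" if "y \<noteq> 0" for y
    using f_scale[OF x, of "norm y" "(1 / norm y) *\<^sub>R y"] that by auto
  show thesis
  proof (rule that[of "f (x, a)" "f (x, b)"])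
    show "f (x, a) * (norm y)\<^sup>2 \<le> f (x, y)" "f (x, y) \<le> f (x, b) * (norm y)\<^sup>2" for y
      using scale[of y] le[of "(1 / norm y) *\<^sub>R y"] zero
      by (cases "y = 0"; simp add: mult.commute mult_left_mono)+
  qed (use pos ab in auto)
qed

lemma has_derivative_slice:
  assumes "a differentiable (at (x, y))"
  shows "((\<lambda>y. a (x, y)) has_derivative (\<lambda>v. dir_deriv (0, v) a (x, y))) (at y)"
proof -
  have "((\<lambda>y. (x, y)) has_derivative (\<lambda>v. (0, v))) (at y)"
    by (auto intro!: derivative_eq_intros)
  from diff_chain_at[OF this dir_deriv_has_derivative[OF assms]] show ?thesis by (simp add: o_def)
qed

end

context linearised_chart
begin

text \<open>For \<alpha> < \<beta> it is positive exactly where \<alpha> < f < \<beta>. The square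
  makes it C^1.\<close>

definition cutoff where "cutoff \<alpha> \<beta> w = (max 0 ((f w - \<alpha>) * (\<beta> - f w)))\<^sup>2"

lemma cutoff_has_derivative:
  assumes z: "z \<in> S"
  shows "(cutoff \<alpha> \<beta> has_derivative (\<lambda>v. 2 * max 0 ((f z - \<alpha>) * (\<beta> - f z)) * (\<alpha> + \<beta> - 2 * f z) * dir_deriv v f z)) (at z)"
proof -
  have f: "(f has_derivative (\<lambda>v. dir_deriv v f z)) (at z)"
    by (rule dir_deriv_has_derivative[OF smooth_differentiable[OF smooth_f z]])
  have q: "((\<lambda>w. (f w - \<alpha>) * (\<beta> - f w)) has_derivative (\<lambda>v. (\<alpha> + \<beta> - 2 * f z) * dir_deriv v f z)) (at z)"
    by (rule derivative_eq_intros f refl | simp add: algebra_simps fun_eq_iff)+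
  show ?thesis
    using has_derivative_compose[OF q DERIV_max_0_square[unfolded has_field_derivative_def]]
    by (simp add: cutoff_def[abs_def] mult.assoc)
qed

lemma D_cutoff_flux:
  assumes z: "z \<in> S"
  shows "(\<lambda>w. cutoff \<alpha> \<beta> w * flux i w) differentiable (at z)"
    "Y i (\<lambda>w. cutoff \<alpha> \<beta> w * flux i w) z = cutoff \<alpha> \<beta> z * Y i (flux i) z
      + 2 * max 0 ((f z - \<alpha>) * (\<beta> - f z)) * (\<alpha> + \<beta> - 2 * f z) * (Y i f z * flux i z)"
proof -
  have d: "cutoff \<alpha> \<beta> differentiable (at z)"
    using cutoff_has_derivative[OF z] unfolding differentiable_def by blast
  have fl: "flux i differentiable (at z)" by (rule smooth_differentiable[OF smooth_flux z])
  show "(\<lambda>w. cutoff \<alpha> \<beta> w * flux i w) differentiable (at z)"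
    using d fl by (rule differentiable_mult)
  show "Y i (\<lambda>w. cutoff \<alpha> \<beta> w * flux i w) z = cutoff \<alpha> \<beta> z * Y i (flux i) z
      + 2 * max 0 ((f z - \<alpha>) * (\<beta> - f z)) * (\<alpha> + \<beta> - 2 * f z) * (Y i f z * flux i z)"
    unfolding dir_deriv_mult[OF d fl] dir_derivI[OF cutoff_has_derivative[OF z]] by simp
qed

lemma hessian_eq_0:
  assumes z: "z \<in> S"
  shows "Y a (Y b u) z = 0"
proof -
  obtain x y0 where xy: "z = (x, y0)" "x \<in> U" "y0 \<noteq> 0" using z by (auto simp: S_def)
  have inS: "(x, y) \<in> S" if "y \<noteq> 0" for y using xy that by (simp add: S_def)
  \<comment> \<open>A window that contains f z in its interior and stays away from 0.\<close>
  define \<alpha> \<beta> where "\<alpha> = f z / 2" and "\<beta> = 2 * f z"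
  have \<alpha>\<beta>: "0 < \<alpha>" "0 < \<beta>" "\<alpha> < \<beta>" using f_pos[OF z] by (simp_all add: \<alpha>_def \<beta>_def)
  obtain m K where mK: "0 < m" "0 < K" "\<And>y. m * (norm y)\<^sup>2 \<le> f (x, y)" "\<And>y. f (x, y) \<le> K * (norm y)\<^sup>2"
    using f_bounds[OF xy(2)] by blast
  define p where "p i y = cutoff \<alpha> \<beta> (x, y) * flux i (x, y)" for i y
  define \<rho> where "\<rho> y = (\<Sum>i\<in>UNIV. dir_deriv (axis i 1) (p i) y)" for y
  have p_diff: "p i differentiable (at y)" and p_deriv: "dir_deriv (axis i 1) (p i) y = cutoff \<alpha> \<beta> (x, y) * Y i (flux i) (x, y)
      + 2 * max 0 ((f (x, y) - \<alpha>) * (\<beta> - f (x, y))) * (\<alpha> + \<beta> - 2 * f (x, y)) * (Y i f (x, y) * flux i (x, y))"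
    if "y \<noteq> 0" for i y
  proof -
    note d = has_derivative_slice[OF D_cutoff_flux(1)[OF inS[OF that], of \<alpha> \<beta> i]]
    show "p i differentiable (at y)" using d unfolding p_def differentiable_def by blast
    show "dir_deriv (axis i 1) (p i) y = cutoff \<alpha> \<beta> (x, y) * Y i (flux i) (x, y)
      + 2 * max 0 ((f (x, y) - \<alpha>) * (\<beta> - f (x, y))) * (\<alpha> + \<beta> - 2 * f (x, y)) * (Y i f (x, y) * flux i (x, y))"
      using dir_derivI[OF d] D_cutoff_flux(2)[OF inS[OF that], of i \<alpha> \<beta>] by (simp add: p_def[abs_def])
  qed
  have cont_slice: "continuous_on (- {0}) (\<lambda>y. a (x, y))" if "smooth a" for a
    by (rule continuous_on_compose2[OF smooth_on_continuous_on[OF that]])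
      (auto intro!: continuous_intros inS)
  have p_cont: "continuous_on (- {0}) (dir_deriv (axis i 1) (p i))" for i
  proof -
    have "continuous_on (- {0}) (\<lambda>y. cutoff \<alpha> \<beta> (x, y) * Y i (flux i) (x, y)
      + 2 * max 0 ((f (x, y) - \<alpha>) * (\<beta> - f (x, y))) * (\<alpha> + \<beta> - 2 * f (x, y)) * (Y i f (x, y) * flux i (x, y)))"
      unfolding cutoff_def by (intro continuous_intros cont_slice) auto
    then show ?thesis by (subst continuous_on_cong[OF refl p_deriv]) auto
  qed
  have cut0: "cutoff \<alpha> \<beta> (x, y) = 0" if "f (x, y) \<le> \<alpha> \<or> f (x, y) \<ge> \<beta>" for y
  proof -
    have "(f (x, y) - \<alpha>) * (\<beta> - f (x, y)) \<le> 0"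
      using that \<alpha>\<beta> by (auto simp: mult_le_0_iff)
    then show ?thesis by (simp add: cutoff_def max_def)
  qed
  \<comment> \<open>For such y the upper bound on f keeps it at most \<alpha>; in
    \<open>p_outer\<close> the lower bound makes it at least \<beta>.\<close>
  have p_inner: "p i y = 0" if "norm y < sqrt (\<alpha> / K)" for i y
  proof -
    have "(norm y)\<^sup>2 < \<alpha> / K" using that by (subst real_sqrt_less_iff[symmetric]) simp
    then have "f (x, y) \<le> \<alpha>" using mK(2) mK(4)[of y] by (simp add: field_simps)
    then show ?thesis by (simp add: p_def cut0)
  qed
  have p_outer: "p i y = 0" if "norm y > sqrt (\<beta> / m)" for i y
  proof -
    have "\<beta> / m < (norm y)\<^sup>2" using that by (subst real_sqrt_less_iff[symmetric]) simp
    then have "f (x, y) \<ge> \<beta>" using mK(1) mK(3)[of y] by (simp add: field_simps)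
    then show ?thesis by (simp add: p_def cut0)
  qed
  have "0 < sqrt (\<alpha> / K)" using \<alpha>\<beta> mK by simp
  note punct = integral_dir_deriv_punctured[OF p_diff p_cont this p_inner p_outer]
  have \<rho>_eq: "\<rho> y = cutoff \<alpha> \<beta> (x, y) * (d (x, y) * (\<Sum>i\<in>UNIV. \<Sum>j\<in>UNIV. V i j (x, y) * Y i (Y j u) (x, y)))"
    if "y \<noteq> 0" for y
    unfolding \<rho>_def p_deriv[OF that] sum.distrib sum_distrib_left[symmetric]
      flux_tangential[OF inS[OF that]] div_flux[OF inS[OF that]] by simp
  have "\<rho> y0 = 0"
  proof (rule continuous_nonneg_integral_eq_0[where \<phi> = \<rho>])
    show "continuous_on UNIV \<rho>" unfolding \<rho>_def[abs_def] by (intro continuous_on_sum punct)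
    show "integrable lborel \<rho>" unfolding \<rho>_def[abs_def] by (intro Bochner_Integration.integrable_sum punct)
    show "integral\<^sup>L lborel \<rho> = 0" unfolding \<rho>_def[abs_def] by (subst Bochner_Integration.integral_sum) (auto simp: punct)
    show "\<rho> y \<ge> 0" for y
    proof (cases "y = 0")
      case True
      then show ?thesis by (simp add: \<rho>_def punct(1))
    next
      case False
      have "(\<Sum>i\<in>UNIV. \<Sum>j\<in>UNIV. V i j (x, y) * Y i (Y j u) (x, y)) \<ge> 0"
        by (rule trace_square_psd(1)[OF h_sym quad_h_nonneg V_eq]) (rule inS[OF False])+
      then show ?thesis using d_pos[OF inS[OF False]] by (simp add: \<rho>_eq[OF False] cutoff_def)
    qed
  qed
  moreover have "cutoff \<alpha> \<beta> z > 0" using f_pos[OF z] by (simp add: cutoff_def \<alpha>_def \<beta>_def)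
  ultimately have "(\<Sum>i\<in>UNIV. \<Sum>j\<in>UNIV. V i j z * Y i (Y j u) z) = 0"
    using \<rho>_eq[OF xy(3)] d_pos[OF z] by (simp add: xy(1))
  \<comment> \<open>From here the two factors h of V are stripped one after the other by lowering,
    until Hess u is left.\<close>
  then have V: "V i j z = 0" for i j
    by (rule trace_square_psd(2)[OF h_sym quad_h_nonneg V_eq, rotated -1]) (rule z)+
  have "M k j z = 0" for k j
    using lower_raise[OF z, of k "\<lambda>k. M k j z"] V by (simp add: V_def)
  then have M: "(\<Sum>l\<in>UNIV. h j l z * Y k (Y l u) z) = 0" for k j
    by (simp add: M_def h_sym[OF z, of j] mult.commute)
  show ?thesis using lower_raise[OF z, of b "\<lambda>l. Y a (Y l u) z"] M by simp
qed

end

context landsberg_chart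
begin

lemma mean_berwald_zero_imp_chern_P_zero:
  assumes E: "\<And>z j k. z \<in> S \<Longrightarrow> mean_berwald F j k z = 0" and z: "z \<in> S"
  shows "chern_P F j i k l z = 0"
proof -
  \<comment> \<open>One component of N at a time; i and k are only labels, since all derivatives
    involved are along the fibre.\<close>
  interpret linearised_chart U F "N i k"
    by unfold_locales (use homog_N trace_B[OF _ E] in auto)
  have "Y l (\<Gamma> i j k) z = Y l (Y j (N i k)) z"
    by (rule D_cong[OF Y_N[symmetric] z])
  then show ?thesis using hessian_eq_0[OF z] by (simp add: chern_P_eq[OF z])
qed

end

section \<open>Finsler manifolds\<close>

lemma finsler_chart_local_expr:
  fixes X :: "'a topology" and \<A> :: "('a, 'n::finite) chart set"
  assumes M: "finsler_manifold X \<A> \<F>" and c: "c \<in> \<A>"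
  shows "finsler_chart (chart_image c) (local_expr \<A> \<F> c)"
proof
  have sm: "smooth_manifold X \<A>" using M by (simp add: finsler_manifold_def)
  then show "open (chart_image c)" using c by (simp add: smooth_manifold_def)
  show "smooth_on (chart_image c \<times> - {0}) (local_expr \<A> \<F> c)"
    using M c by (simp add: finsler_manifold_def slit_domain_def)
  show "v \<bullet> (fundamental_tensor (local_expr \<A> \<F> c) z *v v) > 0"
    if "z \<in> chart_image c \<times> - {0}" "v \<noteq> 0" for z v
    using M c that unfolding finsler_manifold_def slit_domain_def by blast
  fix x y :: "real ^ 'n" and t :: real
  assume x: "x \<in> chart_image c" and t: "t > 0"
  define p where "p = chart_inv c x"
  have p: "p \<in> fst c" "snd c p = x"
    using x by (auto simp: p_def chart_image_def chart_inv_def inv_into_into f_inv_into_f)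
  have top: "p \<in> topspace X" using sm c p by (auto simp: smooth_manifold_def)
  \<comment> \<open>Homogeneity of \<open>\<F>\<close> concerns families of components over all
    charts; it reaches the local expression because each component is linear in y.\<close>
  have "coord_vector \<A> c p (t *\<^sub>R y) = (\<lambda>d. t *\<^sub>R coord_vector \<A> c p y d)"
  proof
    fix d
    have "linear (frechet_derivative (transition c d) (at (snd c p)))" if "d \<in> \<A>" "p \<in> fst d"
    proof (rule linear_frechet_derivative, rule smooth_on_differentiable)
      show "smooth_on (snd c ` (fst c \<inter> fst d)) (transition c d)"
        using sm c that by (simp add: smooth_manifold_def)
    qed (use p that in auto)
    then show "coord_vector \<A> c p (t *\<^sub>R y) d = t *\<^sub>R coord_vector \<A> c p y d"
      by (simp add: coord_vector_def linear_cmul)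
  qed
  moreover have "(p, coord_vector \<A> c p y) \<in> tangent_bundle X \<A>"
    using coord_vector_tangent_space(1)[OF sm c p(1)] top by (simp add: tangent_bundle_def)
  then have "\<F> (p, \<lambda>d. t *\<^sub>R coord_vector \<A> c p y d) = t * \<F> (p, coord_vector \<A> c p y)"
    using M t unfolding finsler_manifold_def by blast
  ultimately show "local_expr \<A> \<F> c (x, t *\<^sub>R y) = t * local_expr \<A> \<F> c (x, y)"
    by (simp add: local_expr_def bundle_chart_inv_def p_def)
qed

theorem theorem4:
  fixes X :: "'a topology"
    and \<A> :: "('a, 'n::finite) chart set"
    and \<F> :: "'a \<times> (('a, 'n) chart \<Rightarrow> real ^ 'n) \<Rightarrow> real"
  assumes "finsler_manifold X \<A> \<F>"
    and "CARD('n) > 2"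
    and "landsberg_manifold X \<A> \<F>"
    and "vanishing_mean_berwald \<A> \<F>"
  shows "berwald_manifold X \<A> \<F>"
  unfolding berwald_manifold_def
proof (intro conjI ballI allI)
  show "finsler_manifold X \<A> \<F>" by fact
  fix c z i j k l
  assume c: "c \<in> \<A>" and z: "z \<in> slit_domain c"
  interpret finsler_chart "chart_image c" "local_expr \<A> \<F> c"
    using assms(1) c by (rule finsler_chart_local_expr)
  interpret landsberg_chart "chart_image c" "local_expr \<A> \<F> c"
    using assms(3) c unfolding landsberg_manifold_def slit_domain_def
    by unfold_locales blast
  show "chern_P (local_expr \<A> \<F> c) j i k l z = 0"
  proof (rule mean_berwald_zero_imp_chern_P_zero)
    show "z \<in> S" using z by (simp add: S_def slit_domain_def)
    show "mean_berwald (local_expr \<A> \<F> c) j k w = 0" if "w \<in> S" for w j k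
      using assms(4) c that unfolding vanishing_mean_berwald_def S_def slit_domain_def by blast
  qed
qed

end
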